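(* Let $\mathcal{C}$ be an indecomposable $2$-Calabi-Yau triangulated category with a cluster tilting object $T$. Then $\mathcal{C}$ has no non-trivial t-structures, i.e. the t-structures in $\mathcal{C}$ are $(\mathcal{C},0)$ and $(0,\mathcal{C})$.
   Context: Fix a field $k$. All triangulated categories are $k$-linear, Hom-finite and Krull-Schmidt, with shift functor $[1]$; $\mathrm{Ext}^n(X,Y)=\mathrm{Hom}(X,Y[n])$. A subcategory means a full subcategory closed under isomorphisms, finite direct sums and direct summands; $\mathrm{add}\,T$ is the subcategory generated by $T$. A triangulated subcategory is a subcategory closed under $[1]$, $[-1]$ and extensions. For subcategories, $\mathcal{X}*\mathcal{Y}$ is the class of objects $Z$ admitting a triangle $X\to Z\to Y\to X[1]$ with $X\in\mathcal{X}$, $Y\in\mathcal{Y}$. $\mathcal{C}$ is $2$-Calabi-Yau if $[2]$ is a Serre functor: $\mathrm{Hom}(X,Y)\cong \mathrm{Hom}_k(\mathrm{Hom}(Y,X[2]),k)$ functorially. $\mathcal{C}$ is indecomposable if there are no two nonzero triangulated subcategories $\mathcal{C}_1,\mathcal{C}_2$ with $\mathrm{Hom}(\mathcal{C}_1,\mathcal{C}_2)=0=\mathrm{Hom}(\mathcal{C}_2,\mathcal{C}_1)$ such that every object is a direct sum of an object of $\mathcal{C}_1$ and one of $\mathcal{C}_2$. A cotorsion pair in $\mathcal{C}$ is a pair $(\mathcal{X},\mathcal{Y})$ of subcategories with $\mathrm{Ext}^1(\mathcal{X},\mathcal{Y})=0$ and $\mathcal{C}=\mathcal{X}*\mathcal{Y}[1]$.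 A t-structure is a cotorsion pair $(\mathcal{X},\mathcal{Y})$ such that $\mathcal{X}$ is closed under $[1]$ (equivalently $\mathcal{Y}$ is closed under $[-1]$). An object $T$ is cluster tilting if $(\mathrm{add}\,T,\mathrm{add}\,T)$ is a cotorsion pair. *)

theory Defs
  imports Complex_Main "HOL-Library.FuncSet"
begin

section \<open>Linear categories\<close>

text \<open>
  All elements of \<open>'o\<close> are objects. The morphism spaces \<open>Hom C X Y\<close> are subspaces of one ambient
  \<open>k\<close>-vector space \<open>'m\<close> (scalar multiplication \<open>Scale C\<close>), and all operations are only
  constrained on these subspaces. The spaces need not be disjoint (they share \<open>0\<close>), so domain and
  codomain are always given explicitly. This is no loss of generality: the morphism spaces of a
  small \<open>k\<close>-linear category embed into their direct sum \<open>\<Oplus>\<^bsub>X,Y\<^esub> Hom(X,Y)\<close>, on which composition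
  is defined bilinearly, as for matrices. \<open>Comp C g f\<close>, written \<open>g \<cdot>\<^bsub>C\<^esub> f\<close>, is "g after f".
\<close>

record ('k, 'o, 'm) linear_cat =
  Hom :: "'o \<Rightarrow> 'o \<Rightarrow> 'm set"
  Comp :: "'m \<Rightarrow> 'm \<Rightarrow> 'm"  (infixr "\<cdot>\<index>" 75)
  Idn :: "'o \<Rightarrow> 'm"
  Scale :: "'k \<Rightarrow> 'm \<Rightarrow> 'm"

locale linear_category =
  fixes C :: "('k::field, 'o, 'm::ab_group_add, 'z) linear_cat_scheme" (structure)
  assumes vector_space: "vector_space (Scale C)"
    and Hom_subspace: "module.subspace (Scale C) (Hom C X Y)"
    and Idn_in_Hom: "Idn C X \<in> Hom C X X"
    and Comp_in_Hom: "\<lbrakk>f \<in> Hom C X Y; g \<in> Hom C Y Z\<rbrakk> \<Longrightarrow> g \<cdot> f \<in> Hom C X Z"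
    and Comp_Idn: "f \<in> Hom C X Y \<Longrightarrow> f \<cdot> Idn C X = f"
    and Idn_Comp: "f \<in> Hom C X Y \<Longrightarrow> Idn C Y \<cdot> f = f"
    and Comp_assoc: "\<lbrakk>f \<in> Hom C W X; g \<in> Hom C X Y; h \<in> Hom C Y Z\<rbrakk>
      \<Longrightarrow> (h \<cdot> g) \<cdot> f = h \<cdot> (g \<cdot> f)"
    and Comp_add_left: "\<lbrakk>f \<in> Hom C X Y; g \<in> Hom C Y Z; g' \<in> Hom C Y Z\<rbrakk>
      \<Longrightarrow> (g + g') \<cdot> f = g \<cdot> f + g' \<cdot> f"
    and Comp_add_right: "\<lbrakk>f \<in> Hom C X Y; f' \<in> Hom C X Y; g \<in> Hom C Y Z\<rbrakk>
      \<Longrightarrow> g \<cdot> (f + f') = g \<cdot> f + g \<cdot> f'"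
    and Comp_scale_left: "\<lbrakk>f \<in> Hom C X Y; g \<in> Hom C Y Z\<rbrakk>
      \<Longrightarrow> (Scale C r g) \<cdot> f = Scale C r (g \<cdot> f)"
    and Comp_scale_right: "\<lbrakk>f \<in> Hom C X Y; g \<in> Hom C Y Z\<rbrakk>
      \<Longrightarrow> g \<cdot> (Scale C r f) = Scale C r (g \<cdot> f)"

definition is_iso :: "('k, 'o, 'm, 'z) linear_cat_scheme \<Rightarrow> 'o \<Rightarrow> 'o \<Rightarrow> 'm \<Rightarrow> bool" where
  "is_iso C X Y f \<longleftrightarrow> f \<in> Hom C X Y \<and>
     (\<exists>g \<in> Hom C Y X. g \<cdot>\<^bsub>C\<^esub> f = Idn C X \<and> f \<cdot>\<^bsub>C\<^esub> g = Idn C Y)"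

definition isomorphic :: "('k, 'o, 'm, 'z) linear_cat_scheme \<Rightarrow> 'o \<Rightarrow> 'o \<Rightarrow> bool" where
  "isomorphic C X Y \<longleftrightarrow> (\<exists>f. is_iso C X Y f)"

definition zero_object :: "('k, 'o, 'm::zero, 'z) linear_cat_scheme \<Rightarrow> 'o \<Rightarrow> bool" where
  "zero_object C N \<longleftrightarrow> (\<forall>X. Hom C N X = {0} \<and> Hom C X N = {0})"

text \<open>
  \<open>Z\<close> is a direct sum of the finite family \<open>Xs\<close>, with injections \<open>i a\<close> and projections \<open>p a\<close>.
  For the empty family this says that the identity of \<open>Z\<close> is zero, i.e. \<open>Z\<close> is a zero object.
\<close>

definition direct_sum ::
  "('k, 'o, 'm::comm_monoid_add, 'z) linear_cat_scheme \<Rightarrow> 'o \<Rightarrow> 'o list \<Rightarrow> bool" where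
  "direct_sum C Z Xs \<longleftrightarrow> (\<exists>i p.
     (\<forall>a < length Xs. i a \<in> Hom C (Xs ! a) Z \<and> p a \<in> Hom C Z (Xs ! a)) \<and>
     (\<forall>a < length Xs. \<forall>b < length Xs.
        p a \<cdot>\<^bsub>C\<^esub> i b = (if a = b then Idn C (Xs ! a) else 0)) \<and>
     (\<Sum>a < length Xs. i a \<cdot>\<^bsub>C\<^esub> p a) = Idn C Z)"

definition hom_finite :: "('k::field, 'o, 'm::ab_group_add, 'z) linear_cat_scheme \<Rightarrow> bool" where
  "hom_finite C \<longleftrightarrow> (\<forall>X Y. \<exists>B. finite B \<and> Hom C X Y = module.span (Scale C) B)"

text \<open>The endomorphism ring is local: it is nonzero and its non-units are closed under addition.\<close>

definition local_End :: "('k, 'o, 'm::{zero,plus}, 'z) linear_cat_scheme \<Rightarrow> 'o \<Rightarrow> bool" where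
  "local_End C X \<longleftrightarrow> Idn C X \<noteq> 0 \<and>
     (\<forall>f \<in> Hom C X X. \<forall>g \<in> Hom C X X.
        \<not> is_iso C X X f \<longrightarrow> \<not> is_iso C X X g \<longrightarrow> \<not> is_iso C X X (f + g))"

definition krull_schmidt :: "('k, 'o, 'm::comm_monoid_add, 'z) linear_cat_scheme \<Rightarrow> bool" where
  "krull_schmidt C \<longleftrightarrow> (\<forall>Z. \<exists>Xs. (\<forall>X \<in> set Xs. local_End C X) \<and> direct_sum C Z Xs)"

section \<open>Triangulated categories\<close>

text \<open>
  The shift is an automorphism (on the nose) of the category, so \<open>[-1]\<close> is \<open>inv (Sh C)\<close> on objects.
  \<open>Dist C X Y Z f g h\<close> says that \<open>X \<rightarrow> Y \<rightarrow> Z \<rightarrow> X[1]\<close>, with maps \<open>f\<close>, \<open>g\<close>, \<open>h\<close>, is a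
  distinguished triangle.
\<close>

record ('k, 'o, 'm) tri_cat = "('k, 'o, 'm) linear_cat" +
  Sh :: "'o \<Rightarrow> 'o"
  ShM :: "'m \<Rightarrow> 'm"
  Dist :: "'o \<Rightarrow> 'o \<Rightarrow> 'o \<Rightarrow> 'm \<Rightarrow> 'm \<Rightarrow> 'm \<Rightarrow> bool"

locale triangulated_category = linear_category C
  for C :: "('k::field, 'o, 'm::ab_group_add, 'z) tri_cat_scheme" (structure) +
  assumes direct_sums: "\<exists>Z. direct_sum C Z Xs"
    and Sh_bij: "bij (Sh C)"
    and ShM_bij: "bij_betw (ShM C) (Hom C X Y) (Hom C (Sh C X) (Sh C Y))"
    and ShM_Idn: "ShM C (Idn C X) = Idn C (Sh C X)"
    and ShM_Comp: "\<lbrakk>f \<in> Hom C X Y; g \<in> Hom C Y Z\<rbrakk> \<Longrightarrow> ShM C (g \<cdot> f) = ShM C g \<cdot> ShM C f"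
    and ShM_add: "\<lbrakk>f \<in> Hom C X Y; f' \<in> Hom C X Y\<rbrakk> \<Longrightarrow> ShM C (f + f') = ShM C f + ShM C f'"
    and ShM_scale: "f \<in> Hom C X Y \<Longrightarrow> ShM C (Scale C r f) = Scale C r (ShM C f)"
    and Dist_Hom: "Dist C X Y Z f g h
      \<Longrightarrow> f \<in> Hom C X Y \<and> g \<in> Hom C Y Z \<and> h \<in> Hom C Z (Sh C X)"
    and TR1_iso: "\<lbrakk>Dist C X Y Z f g h;
        f' \<in> Hom C X' Y'; g' \<in> Hom C Y' Z'; h' \<in> Hom C Z' (Sh C X');
        is_iso C X X' a; is_iso C Y Y' b; is_iso C Z Z' c;
        b \<cdot> f = f' \<cdot> a; c \<cdot> g = g' \<cdot> b; ShM C a \<cdot> h = h' \<cdot> c\<rbrakk>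
      \<Longrightarrow> Dist C X' Y' Z' f' g' h'"
    and TR1_Idn: "zero_object C N \<Longrightarrow> Dist C X X N (Idn C X) 0 0"
    and TR1_cone: "f \<in> Hom C X Y \<Longrightarrow> \<exists>Z g h. Dist C X Y Z f g h"
    and TR2: "\<lbrakk>f \<in> Hom C X Y; g \<in> Hom C Y Z; h \<in> Hom C Z (Sh C X)\<rbrakk>
      \<Longrightarrow> Dist C X Y Z f g h \<longleftrightarrow> Dist C Y Z (Sh C X) g h (- ShM C f)"
    and TR3: "\<lbrakk>Dist C X Y Z f g h; Dist C X' Y' Z' f' g' h';
        a \<in> Hom C X X'; b \<in> Hom C Y Y'; b \<cdot> f = f' \<cdot> a\<rbrakk>
      \<Longrightarrow> \<exists>c \<in> Hom C Z Z'. c \<cdot> g = g' \<cdot> b \<and> ShM C a \<cdot> h = h' \<cdot> c"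
    and TR4: "\<lbrakk>f \<in> Hom C X Y; g \<in> Hom C Y Z;
        Dist C X Y Z' f i i'; Dist C Y Z X' g j j'; Dist C X Z Y' (g \<cdot> f) l l'\<rbrakk>
      \<Longrightarrow> \<exists>u \<in> Hom C Z' Y'. \<exists>v \<in> Hom C Y' X'. Dist C Z' Y' X' u v (ShM C i \<cdot> j') \<and>
            u \<cdot> i = l \<cdot> g \<and> l' \<cdot> u = i' \<and> v \<cdot> l = j \<and> j' \<cdot> v = ShM C f \<cdot> l'"

section \<open>Subcategories\<close>

text \<open>Full subcategories are given by their sets of objects.\<close>

definition subcategory ::
  "('k, 'o, 'm::comm_monoid_add, 'z) linear_cat_scheme \<Rightarrow> 'o set \<Rightarrow> bool" where
  "subcategory C S \<longleftrightarrow>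
     (\<forall>X Y. X \<in> S \<longrightarrow> isomorphic C X Y \<longrightarrow> Y \<in> S) \<and>
     (\<forall>Z Xs. direct_sum C Z Xs \<longrightarrow> set Xs \<subseteq> S \<longrightarrow> Z \<in> S) \<and>
     (\<forall>Z Xs. direct_sum C Z Xs \<longrightarrow> Z \<in> S \<longrightarrow> set Xs \<subseteq> S)"

definition zero_subcat :: "('k, 'o, 'm::zero, 'z) linear_cat_scheme \<Rightarrow> 'o set" where
  "zero_subcat C = {X. zero_object C X}"

definition add_closure :: "('k, 'o, 'm::comm_monoid_add, 'z) linear_cat_scheme \<Rightarrow> 'o \<Rightarrow> 'o set" where
  "add_closure C T = subcategory C hull {T}"

definition Hom_vanish ::
  "('k, 'o, 'm::zero, 'z) linear_cat_scheme \<Rightarrow> 'o set \<Rightarrow> 'o set \<Rightarrow> bool" where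
  "Hom_vanish C A B \<longleftrightarrow> (\<forall>X \<in> A. \<forall>Y \<in> B. Hom C X Y = {0})"

definition star :: "('k, 'o, 'm, 'z) tri_cat_scheme \<Rightarrow> 'o set \<Rightarrow> 'o set \<Rightarrow> 'o set" where
  "star C A B = {Z. \<exists>X \<in> A. \<exists>Y \<in> B. \<exists>f g h. Dist C X Z Y f g h}"

definition triangulated_subcategory ::
  "('k, 'o, 'm::comm_monoid_add, 'z) tri_cat_scheme \<Rightarrow> 'o set \<Rightarrow> bool" where
  "triangulated_subcategory C S \<longleftrightarrow>
     subcategory C S \<and> Sh C ` S \<subseteq> S \<and> inv (Sh C) ` S \<subseteq> S \<and> star C S S \<subseteq> S"

definition indecomposable ::
  "('k, 'o, 'm::comm_monoid_add, 'z) tri_cat_scheme \<Rightarrow> bool" where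
  "indecomposable C \<longleftrightarrow> \<not> (\<exists>C\<^sub>1 C\<^sub>2.
     triangulated_subcategory C C\<^sub>1 \<and> triangulated_subcategory C C\<^sub>2 \<and>
     \<not> C\<^sub>1 \<subseteq> zero_subcat C \<and> \<not> C\<^sub>2 \<subseteq> zero_subcat C \<and>
     Hom_vanish C C\<^sub>1 C\<^sub>2 \<and> Hom_vanish C C\<^sub>2 C\<^sub>1 \<and>
     (\<forall>Z. \<exists>X \<in> C\<^sub>1. \<exists>Y \<in> C\<^sub>2. direct_sum C Z [X, Y]))"

section \<open>The Calabi-Yau condition\<close>

text \<open>
  Functionals on a subspace \<open>V\<close> of \<open>'m\<close> are \<open>undefined\<close> outside \<open>V\<close>, so that equality of
  functionals is equality on \<open>V\<close>.
\<close>

definition dual_space :: "('k::field \<Rightarrow> 'm::ab_group_add \<Rightarrow> 'm) \<Rightarrow> 'm set \<Rightarrow> ('m \<Rightarrow> 'k) set" where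
  "dual_space s V = {\<phi> \<in> extensional V.
     (\<forall>x \<in> V. \<forall>y \<in> V. \<phi> (x + y) = \<phi> x + \<phi> y) \<and> (\<forall>a. \<forall>x \<in> V. \<phi> (s a x) = a * \<phi> x)}"

text \<open>
  \<open>\<eta> X Y\<close> is a linear isomorphism from \<open>Hom(X, Y)\<close> to the dual of \<open>Hom(Y, X[2])\<close>, and the last clause
  is naturality in both variables, for \<open>a : X' \<rightarrow> X\<close> and \<open>b : Y \<rightarrow> Y'\<close>.
\<close>

definition calabi_yau_2 :: "('k::field, 'o, 'm::ab_group_add, 'z) tri_cat_scheme \<Rightarrow> bool" where
  "calabi_yau_2 C \<longleftrightarrow> (\<exists>\<eta> :: 'o \<Rightarrow> 'o \<Rightarrow> 'm \<Rightarrow> 'm \<Rightarrow> 'k.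
     (\<forall>X Y. bij_betw (\<eta> X Y) (Hom C X Y) (dual_space (Scale C) (Hom C Y (Sh C (Sh C X))))) \<and>
     (\<forall>X Y. \<forall>f \<in> Hom C X Y. \<forall>f' \<in> Hom C X Y. \<forall>h \<in> Hom C Y (Sh C (Sh C X)).
        \<eta> X Y (f + f') h = \<eta> X Y f h + \<eta> X Y f' h) \<and>
     (\<forall>X Y c. \<forall>f \<in> Hom C X Y. \<forall>h \<in> Hom C Y (Sh C (Sh C X)).
        \<eta> X Y (Scale C c f) h = c * \<eta> X Y f h) \<and>
     (\<forall>X X' Y Y'. \<forall>a \<in> Hom C X' X. \<forall>b \<in> Hom C Y Y'. \<forall>f \<in> Hom C X Y.
        \<forall>h \<in> Hom C Y' (Sh C (Sh C X')).
        \<eta> X' Y' (b \<cdot>\<^bsub>C\<^esub> f \<cdot>\<^bsub>C\<^esub> a) h = \<eta> X Y f (ShM C (ShM C a) \<cdot>\<^bsub>C\<^esub> h \<cdot>\<^bsub>C\<^esub> b)))"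

section \<open>Cotorsion pairs\<close>

definition cotorsion_pair ::
  "('k, 'o, 'm::comm_monoid_add, 'z) tri_cat_scheme \<Rightarrow> 'o set \<Rightarrow> 'o set \<Rightarrow> bool" where
  "cotorsion_pair C A B \<longleftrightarrow> subcategory C A \<and> subcategory C B \<and>
     Hom_vanish C A (Sh C ` B) \<and> star C A (Sh C ` B) = UNIV"

definition t_structure ::
  "('k, 'o, 'm::comm_monoid_add, 'z) tri_cat_scheme \<Rightarrow> 'o set \<Rightarrow> 'o set \<Rightarrow> bool" where
  "t_structure C A B \<longleftrightarrow> cotorsion_pair C A B \<and> Sh C ` A \<subseteq> A"

definition cluster_tilting ::
  "('k, 'o, 'm::comm_monoid_add, 'z) tri_cat_scheme \<Rightarrow> 'o \<Rightarrow> bool" where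
  "cluster_tilting C T \<longleftrightarrow> cotorsion_pair C (add_closure C T) (add_closure C T)"

end

theory Submission
  imports Defs
begin

text \<open>
  Let \<open>(U, V)\<close> be the torsion pair of a t-structure, with \<open>U[1] \<subseteq> U\<close> and \<open>V = U\<^sup>\<bottom>\<close>; duality gives
  \<open>Hom(V, U[2]) = 0\<close>. If \<open>a \<rightarrow> T \<rightarrow> c[1]\<close> is the truncation of the cluster tilting object \<open>T\<close>, then
  \<open>a \<oplus> c\<close> is rigid, and a rigid object \<open>R\<close> with \<open>T \<in> add R * (add R)[1]\<close> is again cluster tilting.
  For the same reason \<open>a \<oplus> e\<close> with \<open>e = c[-1]\<close> is cluster tilting. Let \<open>Y \<in> V\<close> have no morphisms to
  \<open>V[-1]\<close>. There are no morphisms \<open>a \<rightarrow> Y\<close>, and an approximation argument excludes morphisms \<open>e \<rightarrow> Y\<close>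
  too, so \<open>Y[-1] \<in> add (a \<oplus> e)\<close>, which is only possible for \<open>Y = 0\<close>. Hence \<open>V[1] \<subseteq> V\<close>, so by
  duality all truncation triangles split and \<open>U\<close>, \<open>V\<close> decompose the category.
\<close>

section \<open>Linear categories\<close>

context linear_category
begin

sublocale scale: vector_space "Scale C"
  by (rule vector_space)

lemma zero_in_Hom [simp, intro]: "0 \<in> Hom C X Y"
  by (rule scale.subspace_0[OF Hom_subspace])

lemma add_in_Hom [intro]: "\<lbrakk>f \<in> Hom C X Y; g \<in> Hom C X Y\<rbrakk> \<Longrightarrow> f + g \<in> Hom C X Y"
  by (rule scale.subspace_add[OF Hom_subspace])

lemma scale_in_Hom [intro]: "f \<in> Hom C X Y \<Longrightarrow> Scale C r f \<in> Hom C X Y"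
  by (rule scale.subspace_scale[OF Hom_subspace])

lemma uminus_in_Hom [intro]: "f \<in> Hom C X Y \<Longrightarrow> - f \<in> Hom C X Y"
  by (rule scale.subspace_neg[OF Hom_subspace])

lemma diff_in_Hom [intro]: "\<lbrakk>f \<in> Hom C X Y; g \<in> Hom C X Y\<rbrakk> \<Longrightarrow> f - g \<in> Hom C X Y"
  by (rule scale.subspace_diff[OF Hom_subspace])

lemma sum_in_Hom [intro]: "(\<And>j. j \<in> J \<Longrightarrow> f j \<in> Hom C X Y) \<Longrightarrow> sum f J \<in> Hom C X Y"
  by (induction J rule: infinite_finite_induct) auto

lemmas in_Hom [intro] = Idn_in_Hom Comp_in_Hom

section \<open>Bilinearity of composition\<close>

lemma Comp_zero_left [simp]: "f \<in> Hom C X Y \<Longrightarrow> 0 \<cdot> f = 0"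
  using Comp_add_left[of f X Y 0 Y 0] by simp

lemma Comp_zero_right [simp]: "f \<in> Hom C X Y \<Longrightarrow> f \<cdot> 0 = 0"
  using Comp_add_right[of 0 X X 0 f Y] by simp

lemma Comp_uminus_left: "\<lbrakk>f \<in> Hom C X Y; g \<in> Hom C Y Z\<rbrakk> \<Longrightarrow> (- g) \<cdot> f = - (g \<cdot> f)"
  using Comp_add_left[of f X Y g Z "- g"] by (simp add: uminus_in_Hom eq_neg_iff_add_eq_0 add.commute)

lemma Comp_uminus_right: "\<lbrakk>f \<in> Hom C X Y; g \<in> Hom C Y Z\<rbrakk> \<Longrightarrow> g \<cdot> (- f) = - (g \<cdot> f)"
  using Comp_add_right[of f X Y "- f" g Z] by (simp add: uminus_in_Hom eq_neg_iff_add_eq_0 add.commute)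

lemma Comp_diff_left:
  "\<lbrakk>f \<in> Hom C X Y; g \<in> Hom C Y Z; g' \<in> Hom C Y Z\<rbrakk> \<Longrightarrow> (g - g') \<cdot> f = g \<cdot> f - g' \<cdot> f"
  using Comp_add_left[of f X Y g Z "- g'"] by (simp add: uminus_in_Hom Comp_uminus_left)

lemma Comp_diff_right:
  "\<lbrakk>f \<in> Hom C X Y; f' \<in> Hom C X Y; g \<in> Hom C Y Z\<rbrakk> \<Longrightarrow> g \<cdot> (f - f') = g \<cdot> f - g \<cdot> f'"
  using Comp_add_right[of f X Y "- f'" g Z] by (simp add: uminus_in_Hom Comp_uminus_right)

lemma Comp_sum_left:
  "\<lbrakk>f \<in> Hom C X Y; \<And>j. j \<in> J \<Longrightarrow> g j \<in> Hom C Y Z\<rbrakk> \<Longrightarrow> sum g J \<cdot> f = (\<Sum>j\<in>J. g j \<cdot> f)"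
proof (induction J rule: infinite_finite_induct)
  case (insert j J)
  then show ?case
    using Comp_add_left[of f X Y "g j" Z "sum g J"] by (simp add: sum_in_Hom)
qed simp_all

lemma Comp_sum_right:
  "\<lbrakk>g \<in> Hom C Y Z; \<And>j. j \<in> J \<Longrightarrow> f j \<in> Hom C X Y\<rbrakk> \<Longrightarrow> g \<cdot> sum f J = (\<Sum>j\<in>J. g \<cdot> f j)"
proof (induction J rule: infinite_finite_induct)
  case (insert j J)
  then show ?case
    using Comp_add_right[of "f j" X Y "sum f J" g Z] by (simp add: sum_in_Hom)
qed simp_all

section \<open>Zero objects, direct sums and orthogonal subcategories\<close>

lemma Hom_trivialI: "(\<And>f. f \<in> Hom C X Y \<Longrightarrow> f = 0) \<Longrightarrow> Hom C X Y = {0}"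
  by auto

lemma zero_object_iff: "zero_object C N \<longleftrightarrow> Idn C N = 0"
proof
  assume "zero_object C N"
  then show "Idn C N = 0"
    using Idn_in_Hom[of N] by (simp add: zero_object_def)
next
  assume N: "Idn C N = 0"
  have "f = 0" if "f \<in> Hom C N X" for f X
    using Comp_Idn[OF that] Comp_zero_right[OF that] N by simp
  moreover have "f = 0" if "f \<in> Hom C X N" for f X
    using Idn_Comp[OF that] Comp_zero_left[OF that] N by simp
  ultimately show "zero_object C N"
    unfolding zero_object_def by auto
qed

lemma direct_sumE:
  assumes "direct_sum C Z Xs"
  obtains i p where "\<And>a. a < length Xs \<Longrightarrow> i a \<in> Hom C (Xs ! a) Z"
    "\<And>a. a < length Xs \<Longrightarrow> p a \<in> Hom C Z (Xs ! a)"
    "\<And>a b. \<lbrakk>a < length Xs; b < length Xs\<rbrakk> \<Longrightarrow> p a \<cdot> i b = (if a = b then Idn C (Xs ! a) else 0)"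
    "(\<Sum>a < length Xs. i a \<cdot> p a) = Idn C Z"
proof -
  obtain i p where "\<forall>a < length Xs. i a \<in> Hom C (Xs ! a) Z \<and> p a \<in> Hom C Z (Xs ! a)"
    "\<forall>a < length Xs. \<forall>b < length Xs. p a \<cdot> i b = (if a = b then Idn C (Xs ! a) else 0)"
    "(\<Sum>a < length Xs. i a \<cdot> p a) = Idn C Z"
    using assms unfolding direct_sum_def by (elim exE conjE)
  then show thesis
    by (intro that[of i p]) simp_all
qed

text \<open>Isomorphic copies and direct summands are both retracts, so one retract condition
  replaces two of the three closure clauses.\<close>

lemma subcategoryI:
  assumes retract: "\<And>X Y s r. \<lbrakk>Y \<in> S; s \<in> Hom C X Y; r \<in> Hom C Y X; r \<cdot> s = Idn C X\<rbrakk> \<Longrightarrow> X \<in> S"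
    and sum: "\<And>Z Xs. \<lbrakk>direct_sum C Z Xs; set Xs \<subseteq> S\<rbrakk> \<Longrightarrow> Z \<in> S"
  shows "subcategory C S"
  unfolding subcategory_def
proof (intro conjI allI impI)
  fix X Y
  assume "X \<in> S" "isomorphic C X Y"
  then show "Y \<in> S"
    unfolding isomorphic_def is_iso_def using retract by blast
next
  fix Z Xs
  assume Z: "direct_sum C Z Xs" "Z \<in> S"
  show "set Xs \<subseteq> S"
  proof
    fix X
    assume "X \<in> set Xs"
    then obtain a where "a < length Xs" "Xs ! a = X"
      by (auto simp: in_set_conv_nth)
    then show "X \<in> S"
      using Z(1) retract[OF Z(2), of _ X] unfolding direct_sum_def by metis
  qed
qed (use sum in blast)

lemma subcategory_direct_sum_iff:
  assumes "subcategory C S" "direct_sum C Z Xs"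
  shows "Z \<in> S \<longleftrightarrow> set Xs \<subseteq> S"
proof -
  have "direct_sum C Z Xs \<longrightarrow> set Xs \<subseteq> S \<longrightarrow> Z \<in> S" "direct_sum C Z Xs \<longrightarrow> Z \<in> S \<longrightarrow> set Xs \<subseteq> S"
    using assms(1) unfolding subcategory_def by iprover+
  then show ?thesis
    using assms(2) by iprover
qed

lemma zero_object_in_subcategory:
  assumes "subcategory C S" "zero_object C N"
  shows "N \<in> S"
proof -
  \<comment> \<open>A zero object is the direct sum of the empty family.\<close>
  have "direct_sum C N []"
    using assms(2) by (simp add: direct_sum_def zero_object_iff)
  then show ?thesis
    using subcategory_direct_sum_iff[OF assms(1)] by simp
qed

text \<open>A morphism into a retract is recovered from its composite with the section, one into a
  direct sum from its composites with the projections; all of these vanish.\<close>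

lemma subcategory_right_perp: "subcategory C {Y. \<forall>X\<in>S. Hom C X Y = {0}}"
proof (rule subcategoryI)
  fix X Y s r
  assume Y: "Y \<in> {Y. \<forall>X\<in>S. Hom C X Y = {0}}"
    and s: "s \<in> Hom C X Y" and r: "r \<in> Hom C Y X" and rs: "r \<cdot> s = Idn C X"
  have "f = 0" if "W \<in> S" and f: "f \<in> Hom C W X" for W f
  proof -
    have "s \<cdot> f = 0"
      using Comp_in_Hom[OF f s] Y \<open>W \<in> S\<close> by auto
    then show ?thesis
      using Comp_assoc[OF f s r] rs Idn_Comp[OF f] r by simp
  qed
  then show "X \<in> {Y. \<forall>X\<in>S. Hom C X Y = {0}}"
    by auto
next
  fix Z Xs
  assume Z: "direct_sum C Z Xs" and Xs: "set Xs \<subseteq> {Y. \<forall>X\<in>S. Hom C X Y = {0}}"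
  from Z obtain i p where i: "\<And>a. a < length Xs \<Longrightarrow> i a \<in> Hom C (Xs ! a) Z"
    and p: "\<And>a. a < length Xs \<Longrightarrow> p a \<in> Hom C Z (Xs ! a)"
    and "\<And>a b. \<lbrakk>a < length Xs; b < length Xs\<rbrakk> \<Longrightarrow> p a \<cdot> i b = (if a = b then Idn C (Xs ! a) else 0)"
    and id: "(\<Sum>a < length Xs. i a \<cdot> p a) = Idn C Z"
    by (rule direct_sumE) blast
  have "f = 0" if "W \<in> S" and f: "f \<in> Hom C W Z" for W f
  proof -
    have "f = (\<Sum>a < length Xs. i a \<cdot> p a) \<cdot> f"
      using id Idn_Comp[OF f] by simp
    also have "\<dots> = (\<Sum>a < length Xs. (i a \<cdot> p a) \<cdot> f)"
      using i p by (intro Comp_sum_left[OF f]) auto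
    also have "\<dots> = 0"
    proof (rule sum.neutral, intro ballI)
      fix a
      assume a: "a \<in> {..<length Xs}"
      then have "p a \<cdot> f \<in> Hom C W (Xs ! a)"
        using p f by auto
      then have "p a \<cdot> f = 0"
        using subsetD[OF Xs nth_mem[of a Xs]] a \<open>W \<in> S\<close> by auto
      then show "(i a \<cdot> p a) \<cdot> f = 0"
        using a i[of a] p[of a] f Comp_assoc[of f W Z "p a" "Xs ! a" "i a" Z] by simp
    qed
    finally show ?thesis .
  qed
  then show "Z \<in> {Y. \<forall>X\<in>S. Hom C X Y = {0}}"
    by auto
qed

lemma subcategory_left_perp: "subcategory C {Y. \<forall>X\<in>S. Hom C Y X = {0}}"
proof (rule subcategoryI)
  fix X Y s r
  assume Y: "Y \<in> {Y. \<forall>X\<in>S. Hom C Y X = {0}}"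
    and s: "s \<in> Hom C X Y" and r: "r \<in> Hom C Y X" and rs: "r \<cdot> s = Idn C X"
  have "f = 0" if "W \<in> S" and f: "f \<in> Hom C X W" for W f
  proof -
    have "f \<cdot> r = 0"
      using Comp_in_Hom[OF r f] Y \<open>W \<in> S\<close> by auto
    then show ?thesis
      using Comp_assoc[OF s r f] rs Comp_Idn[OF f] s by simp
  qed
  then show "X \<in> {Y. \<forall>X\<in>S. Hom C Y X = {0}}"
    by auto
next
  fix Z Xs
  assume Z: "direct_sum C Z Xs" and Xs: "set Xs \<subseteq> {Y. \<forall>X\<in>S. Hom C Y X = {0}}"
  from Z obtain i p where i: "\<And>a. a < length Xs \<Longrightarrow> i a \<in> Hom C (Xs ! a) Z"
    and p: "\<And>a. a < length Xs \<Longrightarrow> p a \<in> Hom C Z (Xs ! a)"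
    and "\<And>a b. \<lbrakk>a < length Xs; b < length Xs\<rbrakk> \<Longrightarrow> p a \<cdot> i b = (if a = b then Idn C (Xs ! a) else 0)"
    and id: "(\<Sum>a < length Xs. i a \<cdot> p a) = Idn C Z"
    by (rule direct_sumE) blast
  have "f = 0" if "W \<in> S" and f: "f \<in> Hom C Z W" for W f
  proof -
    have "f = f \<cdot> (\<Sum>a < length Xs. i a \<cdot> p a)"
      using id Comp_Idn[OF f] by simp
    also have "\<dots> = (\<Sum>a < length Xs. f \<cdot> (i a \<cdot> p a))"
      using i p by (intro Comp_sum_right[OF f]) auto
    also have "\<dots> = 0"
    proof (rule sum.neutral, intro ballI)
      fix a
      assume a: "a \<in> {..<length Xs}"
      then have "f \<cdot> i a \<in> Hom C (Xs ! a) W"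
        using i f by auto
      then have "f \<cdot> i a = 0"
        using subsetD[OF Xs nth_mem[of a Xs]] a \<open>W \<in> S\<close> by auto
      then show "f \<cdot> (i a \<cdot> p a) = 0"
        using a i[of a] p[of a] f Comp_assoc[of "p a" Z "Xs ! a" "i a" Z f W] by simp
    qed
    finally show ?thesis .
  qed
  then show "Z \<in> {Y. \<forall>X\<in>S. Hom C Y X = {0}}"
    by auto
qed

subsection \<open>Morphisms factoring through a set of objects\<close>

text \<open>The ideal of morphisms that factor through a finite direct sum of members of
  \<open>R\<close>. Growing it by one composite at a time replaces matrices by induction.\<close>

inductive_set thru for R X Y where
  zero: "0 \<in> thru R X Y"
| add: "\<lbrakk>D \<in> R; f \<in> Hom C X D; g \<in> Hom C D Y; t \<in> thru R X Y\<rbrakk> \<Longrightarrow> g \<cdot> f + t \<in> thru R X Y"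

text \<open>The members of \<open>ad R\<close> are the retracts of finite direct sums of members of \<open>R\<close>; phrased through
  the identity morphism, no direct sum has to be chosen.\<close>

definition ad where
  "ad R = {X. Idn C X \<in> thru R X X}"

lemma thru_in_Hom: "t \<in> thru R X Y \<Longrightarrow> t \<in> Hom C X Y"
  by (induction rule: thru.induct) auto

lemma thru_Comp: "\<lbrakk>D \<in> R; f \<in> Hom C X D; g \<in> Hom C D Y\<rbrakk> \<Longrightarrow> g \<cdot> f \<in> thru R X Y"
  using thru.add[of D R f X g Y 0] thru.zero[of R X Y] by simp

lemma thru_add: "\<lbrakk>t \<in> thru R X Y; t' \<in> thru R X Y\<rbrakk> \<Longrightarrow> t + t' \<in> thru R X Y"
  by (induction rule: thru.induct) (auto simp: add.assoc intro: thru.add)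

lemma thru_sum: "(\<And>j. j \<in> J \<Longrightarrow> t j \<in> thru R X Y) \<Longrightarrow> sum t J \<in> thru R X Y"
  by (induction J rule: infinite_finite_induct) (auto intro: thru.zero thru_add)

lemma thru_Comp_left: "\<lbrakk>t \<in> thru R X Y; h \<in> Hom C Y Z\<rbrakk> \<Longrightarrow> h \<cdot> t \<in> thru R X Z"
proof (induction rule: thru.induct)
  case zero
  then show ?case
    by (simp add: thru.zero)
next
  case (add D f g t)
  have "h \<cdot> (g \<cdot> f + t) = (h \<cdot> g) \<cdot> f + h \<cdot> t"
    using Comp_add_right[of "g \<cdot> f" X Y t h Z] Comp_assoc[of f X D g Y h Z] add thru_in_Hom
    by (simp add: Comp_in_Hom)
  then show ?case
    using add by (auto intro: thru.add)
qed

lemma thru_Comp_right: "\<lbrakk>t \<in> thru R X Y; h \<in> Hom C W X\<rbrakk> \<Longrightarrow> t \<cdot> h \<in> thru R W Y"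
proof (induction rule: thru.induct)
  case zero
  then show ?case
    by (simp add: thru.zero)
next
  case (add D f g t)
  have "(g \<cdot> f + t) \<cdot> h = g \<cdot> (f \<cdot> h) + t \<cdot> h"
    using Comp_add_left[of h W X "g \<cdot> f" Y t] Comp_assoc[of h W X f D g Y] add thru_in_Hom
    by (simp add: Comp_in_Hom)
  then show ?case
    using add by (auto intro: thru.add)
qed

section \<open>The subcategory \<open>ad R\<close>\<close>

lemma ad_base: "D \<in> R \<Longrightarrow> D \<in> ad R"
  using thru_Comp[of D R "Idn C D" D "Idn C D" D] Idn_Comp[OF Idn_in_Hom[of D]]
  by (simp add: ad_def Idn_in_Hom)

lemma ad_retract:
  assumes "Y \<in> ad R" "s \<in> Hom C X Y" "r \<in> Hom C Y X" "r \<cdot> s = Idn C X"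
  shows "X \<in> ad R"
proof -
  have "r \<cdot> (Idn C Y \<cdot> s) \<in> thru R X X"
    using assms by (auto simp: ad_def intro: thru_Comp_left thru_Comp_right)
  then show ?thesis
    using assms by (simp add: ad_def Idn_Comp)
qed

lemma ad_direct_sum:
  assumes "direct_sum C Z Xs" "set Xs \<subseteq> ad R"
  shows "Z \<in> ad R"
proof -
  obtain i p where i: "\<And>a. a < length Xs \<Longrightarrow> i a \<in> Hom C (Xs ! a) Z"
    and p: "\<And>a. a < length Xs \<Longrightarrow> p a \<in> Hom C Z (Xs ! a)"
    and "\<And>a b. \<lbrakk>a < length Xs; b < length Xs\<rbrakk> \<Longrightarrow> p a \<cdot> i b = (if a = b then Idn C (Xs ! a) else 0)"
    and id: "(\<Sum>a < length Xs. i a \<cdot> p a) = Idn C Z"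
    using assms(1) by (rule direct_sumE) blast
  have "i a \<cdot> p a \<in> thru R Z Z" if "a < length Xs" for a
  proof -
    have "Idn C (Xs ! a) \<in> thru R (Xs ! a) (Xs ! a)"
      using subsetD[OF assms(2) nth_mem[OF that]] by (simp add: ad_def)
    then have "i a \<cdot> (Idn C (Xs ! a) \<cdot> p a) \<in> thru R Z Z"
      using i p that by (blast intro: thru_Comp_left thru_Comp_right)
    then show ?thesis
      using Idn_Comp[OF p[OF that]] by simp
  qed
  then show ?thesis
    unfolding ad_def id[symmetric] mem_Collect_eq by (intro thru_sum) auto
qed

lemma subcategory_ad: "subcategory C (ad R)"
  by (rule subcategoryI) (blast intro: ad_retract ad_direct_sum)+

lemma add_closure_subset_ad: "add_closure C T \<subseteq> ad {T}"
  unfolding add_closure_def by (rule hull_minimal) (auto simp: subcategory_ad ad_base)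

lemma zero_object_in_ad: "zero_object C N \<Longrightarrow> N \<in> ad R"
  by (simp add: ad_def zero_object_iff thru.zero)

text \<open>Meant for an identity \<open>t\<close>: a composite through an object of
  \<open>ad R\<close> vanishes if it vanishes along every detour through a member of
  \<open>R\<close>. By bilinearity each summand of \<open>t\<close> is tested separately.\<close>

lemma thru_cancel:
  assumes "t \<in> thru R X Y" and q: "q \<in> Hom C Y Z" and c: "c \<in> Hom C W X"
    and zero: "\<And>D f g. \<lbrakk>D \<in> R; f \<in> Hom C X D; g \<in> Hom C D Y\<rbrakk> \<Longrightarrow> (q \<cdot> g) \<cdot> (f \<cdot> c) = 0"
  shows "q \<cdot> (t \<cdot> c) = 0"
  using assms(1)
proof (induction rule: thru.induct)
  case zero
  then show ?case
    using Comp_zero_left[OF c] Comp_zero_right[OF q] by simp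
next
  case (add D f g t)
  note t = thru_in_Hom[OF add.hyps(4)] and gf = Comp_in_Hom[OF add.hyps(2,3)]
  have "q \<cdot> ((g \<cdot> f + t) \<cdot> c) = q \<cdot> ((g \<cdot> f) \<cdot> c) + q \<cdot> (t \<cdot> c)"
    using Comp_add_left[OF c gf t] Comp_add_right[OF Comp_in_Hom[OF c gf] Comp_in_Hom[OF c t] q]
    by simp
  also have "q \<cdot> ((g \<cdot> f) \<cdot> c) = (q \<cdot> g) \<cdot> (f \<cdot> c)"
    using Comp_assoc[OF c add.hyps(2,3)] Comp_assoc[OF Comp_in_Hom[OF c add.hyps(2)] add.hyps(3) q]
    by simp
  finally show ?case
    using zero[OF add.hyps(1-3)] add.IH by simp
qed

lemma ad_cancel:
  assumes "X \<in> ad R" and q: "q \<in> Hom C X Z" and c: "c \<in> Hom C W X"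
    and "\<And>D f g. \<lbrakk>D \<in> R; f \<in> Hom C X D; g \<in> Hom C D X\<rbrakk> \<Longrightarrow> (q \<cdot> g) \<cdot> (f \<cdot> c) = 0"
  shows "q \<cdot> c = 0"
  using thru_cancel[of "Idn C X" R X X, OF _ q c] assms(1,4) Idn_Comp[OF c] by (simp add: ad_def)

lemma Hom_ad_left:
  assumes "X \<in> ad R" "\<And>D. D \<in> R \<Longrightarrow> Hom C D Y = {0}"
  shows "Hom C X Y = {0}"
proof (rule Hom_trivialI)
  fix q
  assume q: "q \<in> Hom C X Y"
  have "q \<cdot> Idn C X = 0"
  proof (rule ad_cancel[OF assms(1) q Idn_in_Hom])
    fix D f g
    assume "D \<in> R" and f: "f \<in> Hom C X D" and g: "g \<in> Hom C D X"
    then have "q \<cdot> g = 0"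
      using Comp_in_Hom[OF g q] assms(2) by auto
    then show "(q \<cdot> g) \<cdot> (f \<cdot> Idn C X) = 0"
      using Comp_zero_left[OF f] Comp_Idn[OF f] by simp
  qed
  then show "q = 0"
    using Comp_Idn[OF q] by simp
qed

lemma Hom_ad_right:
  assumes "Y \<in> ad R" "\<And>D. D \<in> R \<Longrightarrow> Hom C X D = {0}"
  shows "Hom C X Y = {0}"
proof (rule Hom_trivialI)
  fix c
  assume c: "c \<in> Hom C X Y"
  have "Idn C Y \<cdot> c = 0"
  proof (rule ad_cancel[OF assms(1) Idn_in_Hom c])
    fix D f g
    assume "D \<in> R" and f: "f \<in> Hom C Y D" and g: "g \<in> Hom C D Y"
    then have "f \<cdot> c = 0"
      using Comp_in_Hom[OF c f] assms(2) by auto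
    then show "(Idn C Y \<cdot> g) \<cdot> (f \<cdot> c) = 0"
      using Comp_zero_right[OF g] Idn_Comp[OF g] by simp
  qed
  then show "c = 0"
    using Idn_Comp[OF c] by simp
qed

text \<open>The identity of \<open>E\<close> is a sum of composites \<open>g \<cdot> f\<close>
  through members of \<open>R\<close>. Each \<open>f \<cdot> w\<close> factors through
  \<open>m\<close>, hence so does \<open>w\<close>.\<close>

lemma factor_ad:
  assumes m: "m \<in> Hom C X P"
    and base: "\<And>D v. \<lbrakk>D \<in> R; v \<in> Hom C X D\<rbrakk> \<Longrightarrow> \<exists>k \<in> Hom C P D. v = k \<cdot> m"
    and E: "E \<in> ad R" and w: "w \<in> Hom C X E"
  shows "\<exists>k \<in> Hom C P E. w = k \<cdot> m"
proof -
  \<comment> \<open>Induction cannot run on the identity itself, so \<open>w\<close> is replaced by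
    \<open>t \<cdot> w\<close> with \<open>t\<close> ranging over the ideal.\<close>
  have factor: "\<exists>k \<in> Hom C P E'. t \<cdot> w = k \<cdot> m" if "t \<in> thru R E E'" "w \<in> Hom C X E" for E E' w t
    using that
  proof (induction rule: thru.induct)
    case zero
    then show ?case
      by (intro bexI[of _ 0]) (simp_all add: Comp_zero_left[OF m] Comp_zero_left[OF zero.prems])
  next
    case (add D f g t)
    note t = thru_in_Hom[OF add.hyps(4)]
    obtain k where k: "k \<in> Hom C P E'" "t \<cdot> w = k \<cdot> m"
      using add.IH[OF add.prems] by blast
    obtain k' where k': "k' \<in> Hom C P D" "f \<cdot> w = k' \<cdot> m"
      using base[OF add.hyps(1) Comp_in_Hom[OF add.prems add.hyps(2)]] by blast
    note gk' = Comp_in_Hom[OF k'(1) add.hyps(3)]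
    have "(g \<cdot> f + t) \<cdot> w = g \<cdot> (f \<cdot> w) + t \<cdot> w"
      using Comp_add_left[OF add.prems Comp_in_Hom[OF add.hyps(2,3)] t]
        Comp_assoc[OF add.prems add.hyps(2,3)] by simp
    also have "\<dots> = (g \<cdot> k' + k) \<cdot> m"
      using Comp_add_left[OF m gk' k(1)] Comp_assoc[OF m k'(1) add.hyps(3)] k(2) k'(2) by simp
    finally show ?case
      using add_in_Hom[OF gk' k(1)] by blast
  qed
  show ?thesis
    using factor[OF _ w, of "Idn C E" E] E unfolding Idn_Comp[OF w] ad_def by blast
qed

subsection \<open>Approximations\<close>

text \<open>A single list of pairs is produced because it will index a direct sum. Both
  \<open>X\<close> and \<open>Y\<close> may depend on \<open>D\<close>, which serves left and right
  approximations alike.\<close>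

lemma finite_spanning_family:
  assumes "hom_finite C" "finite R"
  obtains L where "\<And>D v. (D, v) \<in> set L \<Longrightarrow> D \<in> R \<and> v \<in> Hom C (X D) (Y D)"
    "\<And>D. D \<in> R \<Longrightarrow> Hom C (X D) (Y D) = scale.span {v. (D, v) \<in> set L}"
proof -
  have "\<forall>D. \<exists>B. finite B \<and> Hom C (X D) (Y D) = scale.span B"
    using assms(1) by (simp add: hom_finite_def)
  then obtain B where B: "\<And>D. finite (B D)" "\<And>D. Hom C (X D) (Y D) = scale.span (B D)"
    by metis
  obtain L where L: "set L = Sigma R B"
    using finite_list[of "Sigma R B"] assms(2) B(1) by auto
  show thesis
    by (rule that[of L]) (auto simp: L B(2) intro: scale.span_base)
qed

end

section \<open>Triangulated categories\<close>

context triangulated_category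
begin

text \<open>\<open>P\<close> is the sum of one copy of \<open>D\<close> for each morphism
  \<open>X \<rightarrow> D\<close> in a finite spanning family, and \<open>m\<close> has these
  morphisms as its components.\<close>

lemma left_approximation:
  assumes "hom_finite C" "finite R"
  obtains P m where "P \<in> ad R" "m \<in> Hom C X P"
    "\<And>D v. \<lbrakk>D \<in> ad R; v \<in> Hom C X D\<rbrakk> \<Longrightarrow> \<exists>k \<in> Hom C P D. v = k \<cdot> m"
proof -
  obtain L where L: "\<And>D v. (D, v) \<in> set L \<Longrightarrow> D \<in> R \<and> v \<in> Hom C X D"
    and span: "\<And>D. D \<in> R \<Longrightarrow> Hom C X D = scale.span {v. (D, v) \<in> set L}"
    using finite_spanning_family[OF assms, of "\<lambda>_. X" "\<lambda>D. D"] by blast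
  let ?n = "length L"
  define D where "D a = fst (L ! a)" for a
  define v where "v a = snd (L ! a)" for a
  have D: "D a \<in> R" and v: "v a \<in> Hom C X (D a)" if "a < ?n" for a
    using L[of "D a" "v a"] nth_mem[OF that] by (auto simp: D_def v_def)
  obtain P where "direct_sum C P (map D [0..<?n])"
    using direct_sums by blast
  then have P: "P \<in> ad R"
    by (rule ad_direct_sum) (use D ad_base in \<open>simp add: image_subset_iff\<close>)
  from \<open>direct_sum C P (map D [0..<?n])\<close> obtain i p where
    ip: "\<And>a. a < length (map D [0..<?n]) \<Longrightarrow> i a \<in> Hom C (map D [0..<?n] ! a) P"
      "\<And>a. a < length (map D [0..<?n]) \<Longrightarrow> p a \<in> Hom C P (map D [0..<?n] ! a)"
    and pi': "\<And>a b. \<lbrakk>a < length (map D [0..<?n]); b < length (map D [0..<?n])\<rbrakk> \<Longrightarrow>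
      p a \<cdot> i b = (if a = b then Idn C (map D [0..<?n] ! a) else 0)"
    by (rule direct_sumE) blast
  have i: "i a \<in> Hom C (D a) P" and p: "p a \<in> Hom C P (D a)" if "a < ?n" for a
    using ip[of a] that by simp_all
  have pi: "p a \<cdot> i b = (if a = b then Idn C (D a) else 0)" if "a < ?n" "b < ?n" for a b
    using pi'[of a b] that by simp
  define m where "m = (\<Sum>b<?n. i b \<cdot> v b)"
  have m: "m \<in> Hom C X P"
    unfolding m_def using i v by (intro sum_in_Hom) auto
  have pm: "p a \<cdot> m = v a" if a: "a < ?n" for a
  proof -
    have "p a \<cdot> m = (\<Sum>b<?n. p a \<cdot> (i b \<cdot> v b))"
      unfolding m_def using i v p a by (intro Comp_sum_right) auto
    also have "\<dots> = (\<Sum>b<?n. if a = b then v a else 0)"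
    proof (intro sum.cong refl)
      fix b
      assume "b \<in> {..<?n}"
      then have b: "b < ?n"
        by simp
      show "p a \<cdot> (i b \<cdot> v b) = (if a = b then v a else 0)"
        using Comp_assoc[OF v[OF b] i[OF b] p[OF a]] pi[OF a b] Idn_Comp[OF v[OF b]]
          Comp_zero_left[OF v[OF b]] by auto
    qed
    finally show ?thesis
      using a by simp
  qed
  have base: "\<exists>k \<in> Hom C P E. w = k \<cdot> m" if "E \<in> R" "w \<in> Hom C X E" for E w
  proof -
    \<comment> \<open>The morphisms that factor through \<open>m\<close> form a subspace, so it
      suffices to treat the spanning ones, which are the components of \<open>m\<close>.\<close>
    have "scale.span {w. (E, w) \<in> set L} \<subseteq> {w. \<exists>k \<in> Hom C P E. w = k \<cdot> m}"
    proof (rule scale.span_minimal)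
      show "{w. (E, w) \<in> set L} \<subseteq> {w. \<exists>k \<in> Hom C P E. w = k \<cdot> m}"
      proof clarify
        fix w
        assume "(E, w) \<in> set L"
        then obtain a where "a < ?n" "D a = E" "v a = w"
          unfolding D_def v_def by (metis fst_conv snd_conv in_set_conv_nth)
        then show "\<exists>k \<in> Hom C P E. w = k \<cdot> m"
          using pm p by metis
      qed
      show "scale.subspace {w. \<exists>k \<in> Hom C P E. w = k \<cdot> m}"
      proof (rule scale.subspaceI)
        show "0 \<in> {w. \<exists>k \<in> Hom C P E. w = k \<cdot> m}"
          using Comp_zero_left[OF m] zero_in_Hom by (intro CollectI bexI[of _ 0]) simp_all
      next
        fix x y
        assume "x \<in> {w. \<exists>k \<in> Hom C P E. w = k \<cdot> m}" "y \<in> {w. \<exists>k \<in> Hom C P E. w = k \<cdot> m}"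
        then show "x + y \<in> {w. \<exists>k \<in> Hom C P E. w = k \<cdot> m}"
          by (auto simp: Comp_add_left[OF m, symmetric] intro: add_in_Hom)
      next
        fix c x
        assume "x \<in> {w. \<exists>k \<in> Hom C P E. w = k \<cdot> m}"
        then show "Scale C c x \<in> {w. \<exists>k \<in> Hom C P E. w = k \<cdot> m}"
          by (auto simp: Comp_scale_left[OF m, symmetric] intro: scale_in_Hom)
      qed
    qed
    then show ?thesis
      using span that by blast
  qed
  show thesis
    using that[OF P m] factor_ad[OF m base] by blast
qed

text \<open>The dual construction: the sum of the sources of a spanning family, mapped to
  \<open>X\<close> by that family.\<close>

lemma right_approximation:
  assumes "hom_finite C" "finite R"
  obtains P m where "P \<in> ad R" "m \<in> Hom C P X"
    "\<And>D v. \<lbrakk>D \<in> R; v \<in> Hom C D X\<rbrakk> \<Longrightarrow> \<exists>k \<in> Hom C D P. v = m \<cdot> k"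
proof -
  obtain L where L: "\<And>D v. (D, v) \<in> set L \<Longrightarrow> D \<in> R \<and> v \<in> Hom C D X"
    and span: "\<And>D. D \<in> R \<Longrightarrow> Hom C D X = scale.span {v. (D, v) \<in> set L}"
    using finite_spanning_family[OF assms, of "\<lambda>D. D" "\<lambda>_. X"] by blast
  let ?n = "length L"
  define D where "D a = fst (L ! a)" for a
  define v where "v a = snd (L ! a)" for a
  have D: "D a \<in> R" and v: "v a \<in> Hom C (D a) X" if "a < ?n" for a
    using L[of "D a" "v a"] nth_mem[OF that] by (auto simp: D_def v_def)
  obtain P where "direct_sum C P (map D [0..<?n])"
    using direct_sums by blast
  then have P: "P \<in> ad R"
    by (rule ad_direct_sum) (use D ad_base in \<open>simp add: image_subset_iff\<close>)
  from \<open>direct_sum C P (map D [0..<?n])\<close> obtain i p where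
    ip: "\<And>a. a < length (map D [0..<?n]) \<Longrightarrow> i a \<in> Hom C (map D [0..<?n] ! a) P"
      "\<And>a. a < length (map D [0..<?n]) \<Longrightarrow> p a \<in> Hom C P (map D [0..<?n] ! a)"
    and pi': "\<And>a b. \<lbrakk>a < length (map D [0..<?n]); b < length (map D [0..<?n])\<rbrakk> \<Longrightarrow>
      p a \<cdot> i b = (if a = b then Idn C (map D [0..<?n] ! a) else 0)"
    by (rule direct_sumE) blast
  have i: "i a \<in> Hom C (D a) P" and p: "p a \<in> Hom C P (D a)" if "a < ?n" for a
    using ip[of a] that by simp_all
  have pi: "p a \<cdot> i b = (if a = b then Idn C (D a) else 0)" if "a < ?n" "b < ?n" for a b
    using pi'[of a b] that by simp
  define m where "m = (\<Sum>b<?n. v b \<cdot> p b)"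
  have m: "m \<in> Hom C P X"
    unfolding m_def using p v by (intro sum_in_Hom) auto
  have mi: "m \<cdot> i a = v a" if a: "a < ?n" for a
  proof -
    have "m \<cdot> i a = (\<Sum>b<?n. (v b \<cdot> p b) \<cdot> i a)"
      unfolding m_def using i v p a by (intro Comp_sum_left) auto
    also have "\<dots> = (\<Sum>b<?n. if a = b then v a else 0)"
    proof (intro sum.cong refl)
      fix b
      assume "b \<in> {..<?n}"
      then have b: "b < ?n"
        by simp
      show "(v b \<cdot> p b) \<cdot> i a = (if a = b then v a else 0)"
        using Comp_assoc[OF i[OF a] p[OF b] v[OF b]] pi[OF b a] Comp_Idn[OF v[OF b]]
          Comp_zero_right[OF v[OF b]] by auto
    qed
    finally show ?thesis
      using a by simp
  qed
  show thesis
  proof (rule that[OF P m])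
    fix E w
    assume E: "E \<in> R" "w \<in> Hom C E X"
    have "scale.span {w. (E, w) \<in> set L} \<subseteq> {w. \<exists>k \<in> Hom C E P. w = m \<cdot> k}"
    proof (rule scale.span_minimal)
      show "{w. (E, w) \<in> set L} \<subseteq> {w. \<exists>k \<in> Hom C E P. w = m \<cdot> k}"
      proof clarify
        fix w
        assume "(E, w) \<in> set L"
        then obtain a where "a < ?n" "D a = E" "v a = w"
          unfolding D_def v_def by (metis fst_conv snd_conv in_set_conv_nth)
        then show "\<exists>k \<in> Hom C E P. w = m \<cdot> k"
          using mi i by metis
      qed
      show "scale.subspace {w. \<exists>k \<in> Hom C E P. w = m \<cdot> k}"
      proof (rule scale.subspaceI)
        show "0 \<in> {w. \<exists>k \<in> Hom C E P. w = m \<cdot> k}"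
          using Comp_zero_right[OF m] zero_in_Hom by (intro CollectI bexI[of _ 0]) simp_all
      next
        fix x y
        assume "x \<in> {w. \<exists>k \<in> Hom C E P. w = m \<cdot> k}" "y \<in> {w. \<exists>k \<in> Hom C E P. w = m \<cdot> k}"
        then show "x + y \<in> {w. \<exists>k \<in> Hom C E P. w = m \<cdot> k}"
          by (auto simp: Comp_add_right[OF _ _ m, symmetric] intro: add_in_Hom)
      next
        fix c x
        assume "x \<in> {w. \<exists>k \<in> Hom C E P. w = m \<cdot> k}"
        then show "Scale C c x \<in> {w. \<exists>k \<in> Hom C E P. w = m \<cdot> k}"
          by (auto simp: Comp_scale_right[OF _ m, symmetric] intro: scale_in_Hom)
      qed
    qed
    then show "\<exists>k \<in> Hom C E P. w = m \<cdot> k"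
      using span E by blast
  qed
qed

section \<open>The shift functor\<close>

lemma ShM_in_Hom [intro]: "f \<in> Hom C X Y \<Longrightarrow> ShM C f \<in> Hom C (Sh C X) (Sh C Y)"
  by (rule bij_betw_apply[OF ShM_bij])

lemma ShM_surj: "g \<in> Hom C (Sh C X) (Sh C Y) \<Longrightarrow> \<exists>f \<in> Hom C X Y. g = ShM C f"
  using bij_betw_imp_surj_on[OF ShM_bij[of X Y]] by blast

lemma ShM_inject: "\<lbrakk>f \<in> Hom C X Y; g \<in> Hom C X Y\<rbrakk> \<Longrightarrow> ShM C f = ShM C g \<longleftrightarrow> f = g"
  by (rule inj_on_eq_iff[OF bij_betw_imp_inj_on[OF ShM_bij]])

lemma ShM_zero [simp]: "ShM C 0 = 0"
  using ShM_add[OF zero_in_Hom zero_in_Hom] by simp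

lemma Sh_inv [simp]: "Sh C (inv (Sh C) X) = X" "inv (Sh C) (Sh C X) = X"
  using Sh_bij by (simp_all add: bij_is_surj surj_f_inv_f bij_is_inj inv_f_f)

lemma Hom_Sh_trivial_iff: "Hom C (Sh C X) (Sh C Y) = {0} \<longleftrightarrow> Hom C X Y = {0}"
proof
  assume *: "Hom C (Sh C X) (Sh C Y) = {0}"
  show "Hom C X Y = {0}"
  proof (rule Hom_trivialI)
    fix f
    assume f: "f \<in> Hom C X Y"
    then have "ShM C f = ShM C 0"
      using ShM_in_Hom[OF f] * by simp
    then show "f = 0"
      using ShM_inject[OF f zero_in_Hom] by simp
  qed
next
  assume *: "Hom C X Y = {0}"
  show "Hom C (Sh C X) (Sh C Y) = {0}"
  proof (rule Hom_trivialI)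
    fix g
    assume "g \<in> Hom C (Sh C X) (Sh C Y)"
    then show "g = 0"
      using ShM_surj[of g X Y] * by simp
  qed
qed

lemma zero_object_exists: obtains N where "zero_object C N"
proof -
  obtain N where "direct_sum C N []"
    using direct_sums by blast
  then show thesis
    using that by (simp add: direct_sum_def zero_object_iff)
qed

lemma zero_object_Sh_iff: "zero_object C (Sh C N) \<longleftrightarrow> zero_object C N"
  using ShM_inject[OF Idn_in_Hom zero_in_Hom, of N] by (simp add: zero_object_iff ShM_Idn)

section \<open>Rotation of triangles and exactness of Hom\<close>

lemma Dist_rotate: "Dist C X Y Z f g h \<Longrightarrow> Dist C Y Z (Sh C X) g h (- ShM C f)"
  using TR2[of f X Y g Z h] Dist_Hom[of X Y Z f g h] by simp

lemma Dist_unrotate: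
  assumes "Dist C X Y Z f g h"
  obtains W k where "Sh C W = Z" "k \<in> Hom C W X" "ShM C k = - h" "Dist C W X Y k f g"
proof -
  have Hom: "f \<in> Hom C X Y" "g \<in> Hom C Y Z" "h \<in> Hom C Z (Sh C X)"
    using Dist_Hom[OF assms] by auto
  define W where "W = inv (Sh C) Z"
  have W: "Sh C W = Z"
    by (simp add: W_def)
  \<comment> \<open>Desuspending \<open>- h\<close> instead of \<open>h\<close> compensates the sign
    in TR2.\<close>
  obtain k where k: "k \<in> Hom C W X" "- h = ShM C k"
    using ShM_surj[of "- h" W X] uminus_in_Hom[OF Hom(3)] unfolding W by blast
  have "- ShM C k = h"
    using k(2)[symmetric] by simp
  then have "Dist C W X Y k f g"
    using TR2[OF k(1) Hom(1), of g] Hom(2) assms by (simp add: W)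
  then show thesis
    using that[OF W k(1) k(2)[symmetric]] by blast
qed

text \<open>Rotating \<open>X = X \<rightarrow> N\<close> back puts a zero object \<open>W\<close>
  with \<open>W[1] = N\<close> in front, not \<open>N\<close> itself; the triangle is then
  transported along the isomorphism \<open>0\<close> from \<open>W\<close> to
  \<open>N\<close>.\<close>

lemma Dist_zero_left: "zero_object C N \<Longrightarrow> Dist C N X X 0 (Idn C X) 0"
proof -
  assume N: "zero_object C N"
  obtain W k where W: "Sh C W = N" "k \<in> Hom C W X" "Dist C W X X k (Idn C X) 0"
    using Dist_unrotate[OF TR1_Idn[OF N]] by metis
  have "zero_object C W"
    using N W(1) zero_object_Sh_iff by metis
  then have "k = 0"
    using W(2) by (simp add: zero_object_def)
  have "is_iso C W N 0"
    using N \<open>zero_object C W\<close> Comp_zero_left[OF zero_in_Hom]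
    by (auto simp: is_iso_def zero_object_iff intro!: bexI[of _ 0])
  moreover note \<open>k = 0\<close>
  moreover have "is_iso C X X (Idn C X)"
    using Idn_Comp[OF Idn_in_Hom] by (auto simp: is_iso_def Idn_in_Hom)
  ultimately show ?thesis
    using TR1_iso[OF W(3), of 0 N X "Idn C X" X 0 0 "Idn C X" "Idn C X"] Idn_in_Hom[of X]
    by (simp add: Comp_zero_left[OF Idn_in_Hom] Comp_zero_right[OF Idn_in_Hom]
        Comp_zero_left[OF zero_in_Hom] Comp_zero_right[OF zero_in_Hom])
qed

text \<open>Comparing with the triangle on the identity of \<open>X\<close>, TR3 writes
  \<open>g \<cdot> f\<close> as a composite through a zero object.\<close>

lemma Dist_Comp_zero:
  assumes "Dist C X Y Z f g h"
  shows "g \<cdot> f = 0"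
proof -
  have f: "f \<in> Hom C X Y"
    using Dist_Hom[OF assms] by auto
  obtain N where "zero_object C N"
    by (rule zero_object_exists)
  from TR3[OF TR1_Idn[OF this] assms Idn_in_Hom f] obtain c where
    "c \<in> Hom C N Z" "c \<cdot> 0 = g \<cdot> f"
    by blast
  then show ?thesis
    by simp
qed

text \<open>Exactness of \<open>Hom(W, -)\<close>. TR3 only supplies a third component, so both
  triangles are rotated once; the wanted \<open>v\<close> then appears there in shifted
  form.\<close>

lemma Dist_lift:
  assumes "Dist C X Y Z f g h" and u: "u \<in> Hom C W Y" and "g \<cdot> u = 0"
  obtains v where "v \<in> Hom C W X" "u = f \<cdot> v"
proof -
  have f: "f \<in> Hom C X Y" and g: "g \<in> Hom C Y Z"
    using Dist_Hom[OF assms(1)] by auto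
  obtain N where N: "zero_object C N"
    by (rule zero_object_exists)
  have "0 \<cdot> 0 = g \<cdot> u"
    using assms(3) Comp_zero_left[OF zero_in_Hom] by simp
  from TR3[OF Dist_rotate[OF TR1_Idn[OF N]] Dist_rotate[OF assms(1)] u zero_in_Hom this]
  obtain c where c: "c \<in> Hom C (Sh C W) (Sh C X)"
    "ShM C u \<cdot> (- ShM C (Idn C W)) = (- ShM C f) \<cdot> c"
    by blast
  obtain v where v: "v \<in> Hom C W X" "c = ShM C v"
    using ShM_surj[OF c(1)] by blast
  have "- ShM C u = - ShM C (f \<cdot> v)"
    using c(2) v Comp_uminus_left[OF c(1) ShM_in_Hom[OF f]] ShM_Comp[OF v(1) f]
      Comp_uminus_right[OF Idn_in_Hom ShM_in_Hom[OF u]] Comp_Idn[OF ShM_in_Hom[OF u]]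
    by (simp add: ShM_Idn)
  then have "u = f \<cdot> v"
    using ShM_inject[OF u Comp_in_Hom[OF v(1) f]] by simp
  then show thesis
    using that v by blast
qed

text \<open>Exactness of \<open>Hom(-, W)\<close>: the wanted \<open>v\<close> is the third
  component of a map to the triangle \<open>0 \<rightarrow> W = W\<close>.\<close>

lemma Dist_extend:
  assumes "Dist C X Y Z f g h" and u: "u \<in> Hom C Y W" and "u \<cdot> f = 0"
  obtains v where "v \<in> Hom C Z W" "u = v \<cdot> g"
proof -
  obtain N where N: "zero_object C N"
    by (rule zero_object_exists)
  have "u \<cdot> f = 0 \<cdot> 0"
    using assms(3) Comp_zero_left[OF zero_in_Hom] by simp
  from TR3[OF assms(1) Dist_zero_left[OF N] zero_in_Hom u this] obtain c where
    "c \<in> Hom C Z W" "c \<cdot> g = Idn C W \<cdot> u"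
    by blast
  then show thesis
    using that Idn_Comp[OF u] by metis
qed

section \<open>Vanishing of Hom along triangles, and split triangles\<close>

lemma Hom_Dist_left:
  assumes "Dist C X Y Z f g h" "Hom C W X = {0}" "Hom C W Z = {0}"
  shows "Hom C W Y = {0}"
proof (rule Hom_trivialI)
  fix u
  assume u: "u \<in> Hom C W Y"
  have f: "f \<in> Hom C X Y" and g: "g \<in> Hom C Y Z"
    using Dist_Hom[OF assms(1)] by auto
  have "g \<cdot> u = 0"
    using Comp_in_Hom[OF u g] assms(3) by auto
  then obtain v where "v \<in> Hom C W X" "u = f \<cdot> v"
    using Dist_lift[OF assms(1) u] by blast
  then show "u = 0"
    using assms(2) f by simp
qed

lemma Hom_Dist_right:
  assumes "Dist C X Y Z f g h" "Hom C X W = {0}" "Hom C Z W = {0}"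
  shows "Hom C Y W = {0}"
proof (rule Hom_trivialI)
  fix u
  assume u: "u \<in> Hom C Y W"
  have f: "f \<in> Hom C X Y" and g: "g \<in> Hom C Y Z"
    using Dist_Hom[OF assms(1)] by auto
  have "u \<cdot> f = 0"
    using Comp_in_Hom[OF f u] assms(2) by auto
  then obtain v where "v \<in> Hom C Z W" "u = v \<cdot> g"
    using Dist_extend[OF assms(1) u] by blast
  then show "u = 0"
    using assms(3) g by simp
qed

text \<open>The morphism preceding \<open>f\<close> is a desuspension of zero, hence zero, so the
  identity of \<open>X\<close> extends along \<open>f\<close>.\<close>

lemma retract_of_middle:
  assumes "Dist C X Y Z f g 0"
  obtains r where "r \<in> Hom C Y X" "r \<cdot> f = Idn C X"
proof -
  obtain W k where k: "k \<in> Hom C W X" "ShM C k = - 0" "Dist C W X Y k f g"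
    using Dist_unrotate[OF assms] by metis
  then have "Idn C X \<cdot> k = 0"
    using ShM_inject[OF k(1) zero_in_Hom] Comp_zero_right[OF Idn_in_Hom[of X]] by simp
  then show thesis
    using Dist_extend[OF k(3) Idn_in_Hom] that by metis
qed

lemma Dist_epi:
  assumes "Dist C X Y Z f g 0" "u \<in> Hom C Z W" "u \<cdot> g = 0"
  shows "u = 0"
proof -
  obtain v where "v \<in> Hom C (Sh C X) W" "u = v \<cdot> 0"
    using Dist_extend[OF Dist_rotate[OF assms(1)] assms(2,3)] by blast
  then show ?thesis
    by simp
qed

lemma split_triangle:
  assumes D: "Dist C X Y Z f g 0"
  shows "direct_sum C Y [X, Z]"
proof -
  have f: "f \<in> Hom C X Y" and g: "g \<in> Hom C Y Z"
    using Dist_Hom[OF D] by auto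
  obtain r where r: "r \<in> Hom C Y X" and rf: "r \<cdot> f = Idn C X"
    using retract_of_middle[OF D] by blast
  \<comment> \<open>The complement of the idempotent \<open>f \<cdot> r\<close> kills
    \<open>f\<close>, so it factors through \<open>g\<close>; the factor is the section
    \<open>s\<close>.\<close>
  define e where "e = Idn C Y - f \<cdot> r"
  note fr = Comp_in_Hom[OF r f]
  have e: "e \<in> Hom C Y Y"
    unfolding e_def by (intro diff_in_Hom Idn_in_Hom fr)
  have "e \<cdot> f = f - f \<cdot> (r \<cdot> f)"
    unfolding e_def Comp_diff_left[OF f Idn_in_Hom fr] Comp_assoc[OF f r f] Idn_Comp[OF f] ..
  then have "e \<cdot> f = 0"
    by (simp add: rf Comp_Idn[OF f])
  then obtain s where s: "s \<in> Hom C Z Y" and sg: "e = s \<cdot> g"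
    using Dist_extend[OF D e] by blast
  have "g \<cdot> e = g - (g \<cdot> f) \<cdot> r"
    unfolding e_def Comp_diff_right[OF Idn_in_Hom fr g] Comp_assoc[OF r f g] Comp_Idn[OF g] ..
  then have ge: "g \<cdot> e = g"
    by (simp add: Dist_Comp_zero[OF D] Comp_zero_left[OF r])
  have "r \<cdot> e = r - (r \<cdot> f) \<cdot> r"
    unfolding e_def Comp_diff_right[OF Idn_in_Hom fr r] Comp_assoc[OF r f r] Comp_Idn[OF r] ..
  then have re: "r \<cdot> e = 0"
    by (simp add: rf Idn_Comp[OF r])
  note gs = Comp_in_Hom[OF s g]
  \<comment> \<open>By \<open>Dist_epi\<close>, \<open>g\<close> can be cancelled on the right, so
    the equations for \<open>s\<close> are checked after composing with \<open>g\<close>.\<close>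
  have "(g \<cdot> s - Idn C Z) \<cdot> g = 0"
    by (simp add: Comp_diff_left[OF g gs Idn_in_Hom] Comp_assoc[OF g s g] sg[symmetric] ge Idn_Comp[OF g])
  then have gs1: "g \<cdot> s = Idn C Z"
    using Dist_epi[OF D diff_in_Hom[OF gs Idn_in_Hom]] by simp
  have "(r \<cdot> s) \<cdot> g = 0"
    by (simp add: Comp_assoc[OF g s r] sg[symmetric] re)
  then have rs: "r \<cdot> s = 0"
    using Dist_epi[OF D Comp_in_Hom[OF s r]] by simp
  have sum: "f \<cdot> r + s \<cdot> g = Idn C Y"
    unfolding sg[symmetric] e_def by simp
  define i where "i a = (if a = 0 then f else s)" for a :: nat
  define p where "p a = (if a = 0 then r else g)" for a :: nat
  have less2: "a < length [X, Z] \<longleftrightarrow> a = 0 \<or> a = 1" for a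
    by auto
  have lessThan: "{..<length [X, Z]} = {0, 1}"
    by auto
  show ?thesis
    unfolding direct_sum_def
  proof (rule exI[of _ i], rule exI[of _ p], intro conjI)
    show "\<forall>a<length [X, Z]. i a \<in> Hom C ([X, Z] ! a) Y \<and> p a \<in> Hom C Y ([X, Z] ! a)"
      unfolding less2 by (auto simp: i_def p_def f s r g)
    show "\<forall>a<length [X, Z]. \<forall>b<length [X, Z].
        p a \<cdot> i b = (if a = b then Idn C ([X, Z] ! a) else 0)"
      unfolding less2 using rf gs1 rs Dist_Comp_zero[OF D] by (auto simp: i_def p_def)
    show "(\<Sum>a<length [X, Z]. i a \<cdot> p a) = Idn C Y"
      unfolding lessThan using sum by (simp add: i_def p_def)
  qed
qed

section \<open>Calabi-Yau duality\<close>

lemma calabi_yau_2_vanishing: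
  assumes "calabi_yau_2 C" "Hom C Y (Sh C (Sh C X)) = {0}"
  shows "Hom C X Y = {0}"
proof -
  obtain \<eta> where
    "\<forall>X Y. bij_betw (\<eta> X Y) (Hom C X Y) (dual_space (Scale C) (Hom C Y (Sh C (Sh C X))))"
    using assms(1) unfolding calabi_yau_2_def by (elim exE conjE)
  then have inj: "inj_on (\<eta> X Y) (Hom C X Y)"
    and im: "\<eta> X Y ` Hom C X Y = dual_space (Scale C) {0}"
    using assms(2) unfolding bij_betw_def by simp_all
  \<comment> \<open>The dual of the zero space has one element: a functional is zero at
    \<open>0\<close> by additivity and \<open>undefined\<close> elsewhere. Injectivity of
    \<open>\<eta>\<close> then leaves a single morphism.\<close>
  have "\<phi> 0 = 0 \<and> \<phi> \<in> extensional {0}" if "\<phi> \<in> dual_space (Scale C) {0}" for \<phi>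
  proof -
    have "\<phi> (0 + 0) = \<phi> 0 + \<phi> 0" "\<phi> \<in> extensional {0}"
      using that unfolding dual_space_def by blast+
    then show ?thesis
      by (metis add.right_neutral add_left_cancel)
  qed
  then have "\<phi> = \<psi>" if "\<phi> \<in> dual_space (Scale C) {0}" "\<psi> \<in> dual_space (Scale C) {0}" for \<phi> \<psi>
    using that by (intro extensionalityI[of \<phi> "{0}" \<psi>]) (metis singletonD)+
  then have "\<eta> X Y f = \<eta> X Y 0" if "f \<in> Hom C X Y" for f
    using im that zero_in_Hom by blast
  then show ?thesis
    using inj zero_in_Hom by (intro Hom_trivialI) (blast dest: inj_onD)
qed

text \<open>\<open>Hom(X, Y[1])\<close> is dual to \<open>Hom(Y[1], X[2])\<close>, which is the
  shift of \<open>Hom(Y, X[1])\<close>.\<close>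

lemma Ext_symmetric:
  assumes "calabi_yau_2 C" "Hom C Y (Sh C X) = {0}"
  shows "Hom C X (Sh C Y) = {0}"
  using calabi_yau_2_vanishing[OF assms(1), of "Sh C Y" X] assms(2)
  by (simp add: Hom_Sh_trivial_iff)

section \<open>Cluster tilting sets\<close>

lemma Hom_Sh_ad_right:
  assumes "Y \<in> ad R" "\<And>D. D \<in> R \<Longrightarrow> Hom C X (Sh C D) = {0}"
  shows "Hom C X (Sh C Y) = {0}"
proof -
  have "Hom C (inv (Sh C) X) Y = {0}"
    using assms(2) Hom_Sh_trivial_iff[of "inv (Sh C) X"] by (intro Hom_ad_right[OF assms(1)]) simp
  then show ?thesis
    using Hom_Sh_trivial_iff[of "inv (Sh C) X" Y] by simp
qed

definition rigid where
  "rigid R \<longleftrightarrow> (\<forall>D \<in> R. \<forall>E \<in> R. Hom C D (Sh C E) = {0})"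

text \<open>A finite set stands for the direct sum of its members, so that no sum has to be chosen.
  The triangles are coresolutions \<open>X \<rightarrow> P \<rightarrow> N\<close>, a rotation of
  those of the cotorsion pair.\<close>

definition cluster_tilting_set where
  "cluster_tilting_set R \<longleftrightarrow> finite R \<and> rigid R \<and>
     (\<forall>X. \<exists>P \<in> ad R. \<exists>N \<in> ad R. \<exists>f g h. Dist C X P N f g h)"

lemma rigid_ad:
  assumes "rigid R" "X \<in> ad R" "Y \<in> ad R"
  shows "Hom C X (Sh C Y) = {0}"
proof (rule Hom_ad_left[OF assms(2)])
  fix D
  assume "D \<in> R"
  then show "Hom C D (Sh C Y) = {0}"
    using assms(1) by (intro Hom_Sh_ad_right[OF assms(3)]) (simp add: rigid_def)
qed

text \<open>The last property is Wakamatsu's lemma: a morphism \<open>N \<rightarrow> E[1]\<close>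
  kills \<open>n\<close> by rigidity, so it factors through \<open>w\<close> followed by some
  \<open>X[1] \<rightarrow> E[1]\<close>. The latter factors through \<open>m[1]\<close>, and
  \<open>m[1]\<close> kills \<open>w\<close>.\<close>

lemma left_approximation_triangle:
  assumes "hom_finite C" "finite R" "rigid R"
  obtains P N m n w where "Dist C X P N m n w" "P \<in> ad R"
    "\<And>D v. \<lbrakk>D \<in> ad R; v \<in> Hom C X D\<rbrakk> \<Longrightarrow> \<exists>k \<in> Hom C P D. v = k \<cdot> m"
    "\<And>D. D \<in> ad R \<Longrightarrow> Hom C N (Sh C D) = {0}"
proof -
  obtain P m where P: "P \<in> ad R" and m: "m \<in> Hom C X P"
    and factor: "\<And>D v. \<lbrakk>D \<in> ad R; v \<in> Hom C X D\<rbrakk> \<Longrightarrow> \<exists>k \<in> Hom C P D. v = k \<cdot> m"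
    using left_approximation[OF assms(1,2), of X] by metis
  obtain N n w where D: "Dist C X P N m n w"
    using TR1_cone[OF m] by blast
  note D' = Dist_rotate[OF D]
  have n: "n \<in> Hom C P N" and w: "w \<in> Hom C N (Sh C X)"
    using Dist_Hom[OF D] by auto
  have "- ShM C m \<cdot> w = 0"
    by (rule Dist_Comp_zero[OF Dist_rotate[OF D']])
  then have mw: "ShM C m \<cdot> w = 0"
    using Comp_uminus_left[OF w ShM_in_Hom[OF m]] by simp
  have "Hom C N (Sh C E) = {0}" if E: "E \<in> ad R" for E
  proof (rule Hom_trivialI)
    fix \<phi>
    assume \<phi>: "\<phi> \<in> Hom C N (Sh C E)"
    have "\<phi> \<cdot> n = 0"
      using Comp_in_Hom[OF n \<phi>] rigid_ad[OF assms(3) P E] by simp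
    then obtain \<psi> where \<psi>: "\<psi> \<in> Hom C (Sh C X) (Sh C E)" "\<phi> = \<psi> \<cdot> w"
      using Dist_extend[OF D' \<phi>] by blast
    obtain \<chi> where \<chi>: "\<chi> \<in> Hom C X E" "\<psi> = ShM C \<chi>"
      using ShM_surj[OF \<psi>(1)] by blast
    obtain k where k: "k \<in> Hom C P E" "\<chi> = k \<cdot> m"
      using factor[OF E \<chi>(1)] by blast
    have "\<phi> = ShM C k \<cdot> (ShM C m \<cdot> w)"
      using \<psi>(2) \<chi>(2) k(2) ShM_Comp[OF m k(1)] Comp_assoc[OF w ShM_in_Hom[OF m] ShM_in_Hom[OF k(1)]]
      by simp
    then show "\<phi> = 0"
      using mw Comp_zero_right[OF ShM_in_Hom[OF k(1)]] by simp
  qed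
  then show thesis
    using that[OF D P factor] by blast
qed

text \<open>The connecting morphism \<open>N \<rightarrow> X[1]\<close> of a coresolution vanishes,
  which makes \<open>X\<close> a retract of \<open>P\<close>.\<close>

lemma cluster_tilting_set_ad:
  assumes "cluster_tilting_set R" "\<And>D. D \<in> R \<Longrightarrow> Hom C D (Sh C X) = {0}"
  shows "X \<in> ad R"
proof -
  obtain P N f g h where P: "P \<in> ad R" "N \<in> ad R" and D: "Dist C X P N f g h"
    using assms(1) unfolding cluster_tilting_set_def by blast
  have "h \<in> Hom C N (Sh C X)" and f: "f \<in> Hom C X P"
    using Dist_Hom[OF D] by auto
  then have "h = 0"
    using Hom_ad_left[OF P(2) assms(2)] by simp
  then obtain r where "r \<in> Hom C P X" "r \<cdot> f = Idn C X"
    using retract_of_middle[of X P N f g] D by metis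
  then show ?thesis
    using ad_retract[OF P(1) f] by blast
qed

text \<open>The connecting morphism of the \<open>R\<close>-approximation triangle of an object without
  extensions by \<open>R\<close> factors through a morphism \<open>N \<rightarrow> T1\<close> with \<open>T1 \<in> ad S\<close>, and such a morphism only
  sees the part of \<open>T1\<close> that comes from \<open>ad R\<close>.\<close>

lemma cluster_tilting_set_exchange:
  assumes cy: "calabi_yau_2 C" and fin: "hom_finite C" and S: "cluster_tilting_set S"
    and R: "finite R" "rigid R" and SR: "S \<subseteq> star C (ad R) (Sh C ` ad R)"
  shows "cluster_tilting_set R"
proof -
  \<comment> \<open>Maximality of \<open>R\<close> comes first. It then places the third term of
    every approximation triangle in \<open>ad R\<close>, by symmetry of extensions.\<close>
  have perp: "X \<in> ad R" if X: "\<And>D. D \<in> R \<Longrightarrow> Hom C D (Sh C X) = {0}" for X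
  proof -
    have RX: "Hom C E (Sh C X) = {0}" if "E \<in> ad R" for E
      by (rule Hom_ad_left[OF that X])
    have XR: "Hom C X (Sh C E) = {0}" if "E \<in> ad R" for E
      by (rule Ext_symmetric[OF cy RX[OF that]])
    obtain P N m n w where D: "Dist C X P N m n w" and P: "P \<in> ad R"
      and factor: "\<And>D v. \<lbrakk>D \<in> ad R; v \<in> Hom C X D\<rbrakk> \<Longrightarrow> \<exists>k \<in> Hom C P D. v = k \<cdot> m"
      and NR: "\<And>D. D \<in> ad R \<Longrightarrow> Hom C N (Sh C D) = {0}"
      using left_approximation_triangle[OF fin R, of X] by metis
    obtain T0 T1 u p q where T: "T0 \<in> ad S" "T1 \<in> ad S" and DT: "Dist C X T0 T1 u p q"
      using S unfolding cluster_tilting_set_def by blast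
    have m: "m \<in> Hom C X P" and w: "w \<in> Hom C N (Sh C X)"
      using Dist_Hom[OF D] by auto
    have u: "u \<in> Hom C X T0" and q: "q \<in> Hom C T1 (Sh C X)"
      using Dist_Hom[OF DT] by auto
    \<comment> \<open>In a triangle \<open>E \<rightarrow> D \<rightarrow> E'[1]\<close>, the
      composite \<open>W \<rightarrow> D \<rightarrow> E'[1]\<close> is zero, so \<open>v\<close>
      lifts to \<open>E\<close>.\<close>
    have through: "\<exists>E \<in> ad R. \<exists>a \<in> Hom C E D. \<exists>v' \<in> Hom C W E. v = a \<cdot> v'"
      if D: "D \<in> S" and v: "v \<in> Hom C W D" and W: "\<And>E. E \<in> ad R \<Longrightarrow> Hom C W (Sh C E) = {0}" for D v W
    proof -
      obtain E E' a b c where E: "E \<in> ad R" "E' \<in> ad R" and tri: "Dist C E D (Sh C E') a b c"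
        using SR D unfolding star_def by blast
      have a: "a \<in> Hom C E D" and b: "b \<in> Hom C D (Sh C E')"
        using Dist_Hom[OF tri] by auto
      have "b \<cdot> v = 0"
        using Comp_in_Hom[OF v b] W[OF E(2)] by simp
      then obtain v' where "v' \<in> Hom C W E" "v = a \<cdot> v'"
        using Dist_lift[OF tri v] by blast
      then show ?thesis
        using E a by blast
    qed
    \<comment> \<open>This extends the identity of \<open>X\<close> to a map from the
      \<open>R\<close>-approximation triangle to the \<open>S\<close>-coresolution, so that
      \<open>w = q \<cdot> c\<close>.\<close>
    have "\<exists>k \<in> Hom C P T0. u = k \<cdot> m"
    proof (rule factor_ad[OF m _ T(1) u])
      fix D v
      assume "D \<in> S" "v \<in> Hom C X D"
      then obtain E a v' where E: "E \<in> ad R" "a \<in> Hom C E D" "v' \<in> Hom C X E" "v = a \<cdot> v'"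
        using through[OF _ _ XR] by blast
      obtain k where k: "k \<in> Hom C P E" "v' = k \<cdot> m"
        using factor[OF E(1,3)] by blast
      have "v = (a \<cdot> k) \<cdot> m"
        using E(4) k(2) Comp_assoc[OF m k(1) E(2)] by simp
      then show "\<exists>k \<in> Hom C P D. v = k \<cdot> m"
        using Comp_in_Hom[OF k(1) E(2)] by blast
    qed
    then obtain k where k: "k \<in> Hom C P T0" "k \<cdot> m = u \<cdot> Idn C X"
      using Comp_Idn[OF u] by metis
    obtain c where c: "c \<in> Hom C N T1" "ShM C (Idn C X) \<cdot> w = q \<cdot> c"
      using TR3[OF D DT Idn_in_Hom k] by blast
    have "q \<cdot> c = 0"
    proof (rule ad_cancel[OF T(2) q c(1)])
      fix D f g
      assume "D \<in> S" and f: "f \<in> Hom C T1 D" and g: "g \<in> Hom C D T1"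
      then obtain E a v where E: "E \<in> ad R" "a \<in> Hom C E D" "v \<in> Hom C N E" "f \<cdot> c = a \<cdot> v"
        using through[OF _ Comp_in_Hom[OF c(1) f] NR] by blast
      note qg = Comp_in_Hom[OF g q]
      have "(q \<cdot> g) \<cdot> a = 0"
        using Comp_in_Hom[OF E(2) qg] RX[OF E(1)] by simp
      then show "(q \<cdot> g) \<cdot> (f \<cdot> c) = 0"
        using E(4) Comp_assoc[OF E(3,2) qg] Comp_zero_left[OF E(3)] by simp
    qed
    then have "w = 0"
      using c(2) Idn_Comp[OF w] by (simp add: ShM_Idn)
    then obtain r where "r \<in> Hom C P X" "r \<cdot> m = Idn C X"
      using retract_of_middle[of X P N m n] D by metis
    then show ?thesis
      using ad_retract[OF P m] by blast
  qed
  have "\<exists>P \<in> ad R. \<exists>N \<in> ad R. \<exists>f g h. Dist C X P N f g h" for X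
  proof -
    obtain P N m n w where D: "Dist C X P N m n w" and P: "P \<in> ad R"
      and NR: "\<And>D. D \<in> ad R \<Longrightarrow> Hom C N (Sh C D) = {0}"
      using left_approximation_triangle[OF fin R, of X] by metis
    have "N \<in> ad R"
      using Ext_symmetric[OF cy NR] ad_base by (intro perp) blast
    then show ?thesis
      using D P by blast
  qed
  then show ?thesis
    using R by (simp add: cluster_tilting_set_def)
qed

lemma cluster_tilting_set_singleton:
  assumes "cluster_tilting C T"
  shows "cluster_tilting_set {T}"
proof -
  have van: "Hom_vanish C (add_closure C T) (Sh C ` add_closure C T)"
    and star: "star C (add_closure C T) (Sh C ` add_closure C T) = UNIV"
    using assms by (simp_all add: cluster_tilting_def cotorsion_pair_def)
  have "T \<in> add_closure C T"
    unfolding add_closure_def by (rule hull_inc) simp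
  then have "rigid {T}"
    using van by (simp add: rigid_def Hom_vanish_def)
  moreover have "\<exists>P \<in> ad {T}. \<exists>N \<in> ad {T}. \<exists>f g h. Dist C X P N f g h" for X
  proof -
    \<comment> \<open>The triangle \<open>T0 \<rightarrow> X[1] \<rightarrow> T1[1]\<close> rotates
      back twice to the coresolution \<open>X \<rightarrow> T1 \<rightarrow> T0\<close>.\<close>
    have "Sh C X \<in> star C (add_closure C T) (Sh C ` add_closure C T)"
      by (simp add: star)
    then obtain T0 T1 f g h where T: "T0 \<in> ad {T}" "T1 \<in> ad {T}"
      and D: "Dist C T0 (Sh C X) (Sh C T1) f g h"
      using add_closure_subset_ad unfolding star_def by blast
    obtain W k where W: "Sh C W = Sh C T1" "Dist C W T0 (Sh C X) k f g"
      using Dist_unrotate[OF D] by metis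
    obtain W' k' where W': "Sh C W' = Sh C X" "Dist C W' W T0 k' k f"
      using Dist_unrotate[OF W(2)] by metis
    have "W = T1" "W' = X"
      using W(1) W'(1) Sh_inv(2) by metis+
    then show ?thesis
      using W'(2) T by blast
  qed
  ultimately show ?thesis
    by (simp add: cluster_tilting_set_def)
qed

end

section \<open>Aisles\<close>

text \<open>Only the aisle is fixed. The shifted second half of a t-structure is replaced by the
  right orthogonal \<open>V\<close> of \<open>U\<close>.\<close>

locale aisle = triangulated_category C
  for C :: "('k::field, 'o, 'm::ab_group_add, 'z) tri_cat_scheme" (structure) +
  fixes U :: "'o set"
  assumes Sh_U: "X \<in> U \<Longrightarrow> Sh C X \<in> U"
    and truncation: "\<exists>X \<in> U. \<exists>Y. (\<forall>W \<in> U. Hom C W Y = {0}) \<and> (\<exists>f g h. Dist C X Z Y f g h)"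
    and cy: "calabi_yau_2 C"
begin

definition V where
  "V = {Y. \<forall>X \<in> U. Hom C X Y = {0}}"

lemma Hom_U_V: "\<lbrakk>X \<in> U; Y \<in> V\<rbrakk> \<Longrightarrow> Hom C X Y = {0}"
  by (simp add: V_def)

lemma truncationE:
  obtains X Y f g h where "X \<in> U" "Y \<in> V" "Dist C X Z Y f g h"
proof -
  obtain X Y f g h where "X \<in> U" "\<forall>W \<in> U. Hom C W Y = {0}" "Dist C X Z Y f g h"
    using truncation[of Z] by blast
  then show thesis
    using that[of X Y f g h] by (simp add: V_def)
qed

lemma V_unshift:
  assumes "Sh C Y \<in> V"
  shows "Y \<in> V"
proof -
  have "Hom C X Y = {0}" if "X \<in> U" for X
    using Hom_U_V[OF Sh_U[OF that] assms] by (simp add: Hom_Sh_trivial_iff)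
  then show ?thesis
    by (simp add: V_def)
qed

text \<open>\<open>Hom(Y, X[2])\<close> is dual to \<open>Hom(X[2], Y[2])\<close>, the double shift
  of \<open>Hom(X, Y)\<close>.\<close>

lemma Hom_V_Sh2_U:
  assumes "X \<in> U" "Y \<in> V"
  shows "Hom C Y (Sh C (Sh C X)) = {0}"
  by (rule calabi_yau_2_vanishing[OF cy]) (simp add: Hom_Sh_trivial_iff Hom_U_V[OF assms])

text \<open>Truncating a cluster tilting object \<open>T\<close> as \<open>a \<rightarrow> T \<rightarrow> c[1]\<close> makes \<open>a \<oplus> c\<close> cluster tilting;
  doing the same with \<open>a \<oplus> c\<close> in place of \<open>T\<close> moves \<open>c\<close> further away from \<open>a\<close>, to \<open>e = c[-1]\<close>.\<close>

lemma split_cluster_tilting_set: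
  assumes fin: "hom_finite C" and T: "cluster_tilting_set {T}"
  obtains a e where "cluster_tilting_set {a, e}" "a \<in> U" "Sh C (Sh C e) \<in> V"
proof -
  obtain a b f g h where a: "a \<in> U" and b: "b \<in> V" and D: "Dist C a T b f g h"
    by (rule truncationE)
  define c where "c = inv (Sh C) b"
  define e where "e = inv (Sh C) c"
  have Sh: "Sh C c = b" "Sh C e = c"
    by (simp_all add: c_def e_def)
  have f: "f \<in> Hom C a T" and g: "g \<in> Hom C T b" and h: "h \<in> Hom C b (Sh C a)"
    using Dist_Hom[OF D] by auto
  have TT: "Hom C T (Sh C T) = {0}"
    using T by (simp add: cluster_tilting_set_def rigid_def)
  \<comment> \<open>As \<open>Hom(b[-1], a[1]) = 0\<close>, \<phi> extends along \<open>f\<close> to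
    \<psi> on \<open>T\<close>. Rigidity of \<open>T\<close> gives
    \<open>f[1] \<cdot> \<psi> = 0\<close>, so \<phi> factors through a morphism
    \<open>a \<rightarrow> b\<close>, which is zero.\<close>
  have aa: "Hom C a (Sh C a) = {0}"
  proof (rule Hom_trivialI)
    fix \<phi>
    assume \<phi>: "\<phi> \<in> Hom C a (Sh C a)"
    obtain W k where W: "Sh C W = b" "k \<in> Hom C W a" "Dist C W a T k f g"
      using Dist_unrotate[OF D] by metis
    have "Hom C W (Sh C a) = {0}"
      using Hom_V_Sh2_U[OF a b] W(1) Hom_Sh_trivial_iff[of W "Sh C a"] by simp
    then have "\<phi> \<cdot> k = 0"
      using Comp_in_Hom[OF W(2) \<phi>] by simp
    then obtain \<psi> where \<psi>: "\<psi> \<in> Hom C T (Sh C a)" "\<phi> = \<psi> \<cdot> f"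
      using Dist_extend[OF W(3) \<phi>] by blast
    note mf = uminus_in_Hom[OF ShM_in_Hom[OF f]]
    have "- ShM C f \<cdot> \<psi> = 0"
      using Comp_in_Hom[OF \<psi>(1) mf] TT by simp
    then have "- ShM C f \<cdot> \<phi> = 0"
      using \<psi>(2) Comp_assoc[OF f \<psi>(1) mf] Comp_zero_left[OF f] by simp
    then obtain v where "v \<in> Hom C a b" "\<phi> = h \<cdot> v"
      using Dist_lift[OF Dist_rotate[OF Dist_rotate[OF D]] \<phi>] by blast
    then show "\<phi> = 0"
      using Hom_U_V[OF a b] Comp_zero_right[OF h] by simp
  qed
  \<comment> \<open>Dually, \<phi> lifts to \<psi> with target \<open>T[1]\<close> because
    \<open>Hom(b, a[2]) = 0\<close>. Rigidity of \<open>T\<close> kills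
    \<open>\<psi> \<cdot> g\<close>, so \<phi> factors through a morphism
    \<open>a[1] \<rightarrow> b[1]\<close>.\<close>
  have bb: "Hom C b (Sh C b) = {0}"
  proof (rule Hom_trivialI)
    fix \<phi>
    assume \<phi>: "\<phi> \<in> Hom C b (Sh C b)"
    note mg = uminus_in_Hom[OF ShM_in_Hom[OF g]] and mh = uminus_in_Hom[OF ShM_in_Hom[OF h]]
    note D4 = Dist_rotate[OF Dist_rotate[OF Dist_rotate[OF Dist_rotate[OF D]]]]
    have "- ShM C h \<cdot> \<phi> = 0"
      using Comp_in_Hom[OF \<phi> mh] Hom_V_Sh2_U[OF a b] by simp
    then obtain \<psi> where \<psi>: "\<psi> \<in> Hom C b (Sh C T)" "\<phi> = - ShM C g \<cdot> \<psi>"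
      using Dist_lift[OF D4 \<phi>] by blast
    have "\<psi> \<cdot> g = 0"
      using Comp_in_Hom[OF g \<psi>(1)] TT by simp
    then have "\<phi> \<cdot> g = 0"
      using \<psi>(2) Comp_assoc[OF g \<psi>(1) mg] Comp_zero_right[OF mg] by simp
    then obtain v where "v \<in> Hom C (Sh C a) (Sh C b)" "\<phi> = v \<cdot> h"
      using Dist_extend[OF Dist_rotate[OF D] \<phi>] by blast
    then show "\<phi> = 0"
      using Hom_U_V[OF a b] Hom_Sh_trivial_iff[of a b] Comp_zero_left[OF h] by simp
  qed
  \<comment> \<open>As \<open>b = c[1]\<close> and \<open>c = e[1]\<close>, extensions of
    \<open>a\<close> by \<open>c\<close> or \<open>e\<close> are morphisms from \<open>U\<close> to
    \<open>V\<close>; the opposite extensions vanish by duality.\<close>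
  have ab: "Hom C a b = {0}"
    by (rule Hom_U_V[OF a b])
  have c: "c \<in> V"
    using b Sh V_unshift by simp
  have ac: "Hom C a c = {0}"
    by (rule Hom_U_V[OF a c])
  have cb: "Hom C c b = {0}"
    using bb Hom_Sh_trivial_iff[of c b] Sh by simp
  have ec: "Hom C e c = {0}"
    using cb Hom_Sh_trivial_iff[of e c] Sh by simp
  have "Hom C c (Sh C a) = {0}" "Hom C e (Sh C a) = {0}"
    using Ext_symmetric[OF cy, of a c] Ext_symmetric[OF cy, of a e] ab ac Sh by simp_all
  then have rigid: "rigid {a, c}" "rigid {a, e}"
    using aa ab ac cb ec Sh by (auto simp: rigid_def)
  have "T \<in> star C (ad {a, c}) (Sh C ` ad {a, c})"
    using D ad_base[of a "{a, c}"] ad_base[of c "{a, c}"] unfolding star_def Sh(1)[symmetric] by blast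
  then have ac: "cluster_tilting_set {a, c}"
    using cluster_tilting_set_exchange[OF cy fin T _ rigid(1)] by simp
  obtain N where N: "zero_object C (Sh C N)" "zero_object C N"
    using zero_object_exists zero_object_Sh_iff by metis
  \<comment> \<open>The trivial triangles \<open>a = a \<rightarrow> 0\<close> and
    \<open>0 \<rightarrow> e[1] = c\<close> suffice for the second exchange.\<close>
  have "a \<in> star C (ad {a, e}) (Sh C ` ad {a, e})"
    using TR1_Idn[OF N(1), of a] ad_base[of a "{a, e}"] zero_object_in_ad[OF N(2), of "{a, e}"]
    unfolding star_def by blast
  moreover have "c \<in> star C (ad {a, e}) (Sh C ` ad {a, e})"
    using Dist_zero_left[OF N(2), of c] ad_base[of e "{a, e}"] zero_object_in_ad[OF N(2), of "{a, e}"] Sh(2)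
    unfolding star_def by blast
  ultimately have "cluster_tilting_set {a, e}"
    using cluster_tilting_set_exchange[OF cy fin ac _ rigid(2)] by simp
  then show thesis
    using that a b Sh by simp
qed

text \<open>The cocone \<open>Z\<close> of the \<open>e\<close>-approximation \<open>c0 \<rightarrow> Y\<close> lies in \<open>ad {a, e}\<close>, and \<open>f : Z \<rightarrow> c0\<close> does
  not see \<open>a\<close>, so \<open>f\<close> is a split epimorphism. Hence \<open>Hom(e, Y) = 0\<close>, and \<open>Y[-1]\<close> lies in
  \<open>ad {a, e}\<close> although its identity factors neither through \<open>a\<close> nor through \<open>e\<close>.\<close>

lemma zero_object_in_heart:
  assumes fin: "hom_finite C" and R: "cluster_tilting_set {a, e}"
    and a: "a \<in> U" and SSe: "Sh C (Sh C e) \<in> V"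
    and Y: "Y \<in> V" "\<And>W. Sh C W \<in> V \<Longrightarrow> Hom C Y W = {0}"
  shows "zero_object C Y"
proof -
  have Se: "Sh C e \<in> V" and e: "e \<in> V"
    using SSe V_unshift by blast+
  have rigid: "rigid {a, e}"
    using R by (simp add: cluster_tilting_set_def)
  obtain c0 q where c0: "c0 \<in> ad {e}" and q: "q \<in> Hom C c0 Y"
    and approx: "\<And>v. v \<in> Hom C e Y \<Longrightarrow> \<exists>k \<in> Hom C e c0. v = q \<cdot> k"
    using right_approximation[OF fin, of "{e}" Y] by (metis finite.emptyI finite.insertI insertI1)
  obtain K w g where "Dist C c0 Y K q w g"
    using TR1_cone[OF q] by blast
  then obtain Z f where D: "Dist C Z c0 Y f q w"
    using Dist_unrotate by metis
  obtain W j where W: "Sh C W = Y" and j: "j \<in> Hom C W Z" and D0: "Dist C W Z c0 j f q"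
    using Dist_unrotate[OF D] by metis
  have f: "f \<in> Hom C Z c0" and w: "w \<in> Hom C Y (Sh C Z)"
    using Dist_Hom[OF D] by auto
  have ac0: "Hom C a c0 = {0}"
    using Hom_U_V[OF a e] by (intro Hom_ad_right[OF c0]) simp
  have Yc0: "Hom C Y c0 = {0}"
    using Y(2)[OF Se] by (intro Hom_ad_right[OF c0]) simp
  \<comment> \<open>A morphism \<open>E \<rightarrow> Z[1]\<close> comes from some
    \<open>v : E \<rightarrow> Y\<close>. For \<open>E = a\<close> this \<open>v\<close> is zero;
    for \<open>E = e\<close> it factors through \<open>q\<close>, and
    \<open>w \<cdot> q = 0\<close>.\<close>
  have "Hom C E (Sh C Z) = {0}" if E: "E \<in> {a, e}" for E
  proof (rule Hom_trivialI)
    fix \<phi>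
    assume \<phi>: "\<phi> \<in> Hom C E (Sh C Z)"
    have "Hom C E (Sh C c0) = {0}"
      using rigid E by (intro Hom_Sh_ad_right[OF c0]) (auto simp: rigid_def)
    then have "- ShM C f \<cdot> \<phi> = 0"
      using Comp_in_Hom[OF \<phi> uminus_in_Hom[OF ShM_in_Hom[OF f]]] by simp
    then obtain v where v: "v \<in> Hom C E Y" "\<phi> = w \<cdot> v"
      using Dist_lift[OF Dist_rotate[OF Dist_rotate[OF D]] \<phi>] by blast
    show "\<phi> = 0"
    proof (cases "E = a")
      case True
      then show ?thesis
        using v Hom_U_V[OF a Y(1)] Comp_zero_right[OF w] by simp
    next
      case False
      then obtain k where k: "k \<in> Hom C E c0" "v = q \<cdot> k"
        using E approx v(1) by blast
      have "w \<cdot> q = 0"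
        by (rule Dist_Comp_zero[OF Dist_rotate[OF D]])
      then show ?thesis
        using v(2) k(2) Comp_assoc[OF k(1) q w] Comp_zero_left[OF k(1)] by simp
    qed
  qed
  then have Z: "Z \<in> ad {a, e}"
    by (rule cluster_tilting_set_ad[OF R])
  \<comment> \<open>For \<open>t\<close> the identity this reads
    \<open>f = f \<cdot> k \<cdot> f\<close>. Summands of \<open>t\<close> through \<open>a\<close>
    are killed by \<open>f\<close>; for those through \<open>e\<close>, the morphism
    \<open>p : Z \<rightarrow> e\<close> extends along \<open>f\<close> because
    \<open>Hom(Y[-1], e) = 0\<close>.\<close>
  have "\<exists>k \<in> Hom C c0 Z. f \<cdot> t = f \<cdot> (k \<cdot> f)" if "t \<in> thru {a, e} Z Z" for t
    using that
  proof (induction rule: thru.induct)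
    case zero
    show ?case
      by (intro bexI[of _ 0]) (simp_all add: Comp_zero_left[OF f])
  next
    case (add E p g t)
    note p = add.hyps(2) and g = add.hyps(3) and t = thru_in_Hom[OF add.hyps(4)]
    obtain k where k: "k \<in> Hom C c0 Z" "f \<cdot> t = f \<cdot> (k \<cdot> f)"
      using add.IH by blast
    have split: "f \<cdot> (g \<cdot> p + t) = f \<cdot> (g \<cdot> p) + f \<cdot> t"
      by (rule Comp_add_right[OF Comp_in_Hom[OF p g] t f])
    show ?case
    proof (cases "E = a")
      case True
      then have "f \<cdot> g = 0"
        using Comp_in_Hom[OF g f] ac0 by simp
      then have "f \<cdot> (g \<cdot> p) = 0"
        using Comp_assoc[OF p g f] Comp_zero_left[OF p] by simp
      then show ?thesis
        using split k by auto
    next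
      case False
      then have E: "E = e"
        using add.hyps(1) by simp
      have "Hom C W e = {0}"
        using Y(2)[OF SSe] Hom_Sh_trivial_iff[of W e] W by simp
      then have "p \<cdot> j = 0"
        using Comp_in_Hom[OF j p] E by simp
      then obtain l where l: "l \<in> Hom C c0 E" "p = l \<cdot> f"
        using Dist_extend[OF D0 p] by blast
      note gl = Comp_in_Hom[OF l(1) g]
      have "f \<cdot> (g \<cdot> p + t) = f \<cdot> ((g \<cdot> l) \<cdot> f) + f \<cdot> (k \<cdot> f)"
        using split k(2) l(2) Comp_assoc[OF f l(1) g] by simp
      also have "\<dots> = f \<cdot> ((g \<cdot> l + k) \<cdot> f)"
        using Comp_add_left[OF f gl k(1)]
          Comp_add_right[OF Comp_in_Hom[OF f gl] Comp_in_Hom[OF f k(1)] f] by simp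
      finally show ?thesis
        using add_in_Hom[OF gl k(1)] by blast
    qed
  qed
  then have "\<exists>k \<in> Hom C c0 Z. f \<cdot> Idn C Z = f \<cdot> (k \<cdot> f)"
    using Z by (simp add: ad_def)
  then obtain k where k: "k \<in> Hom C c0 Z" "f = f \<cdot> (k \<cdot> f)"
    using Comp_Idn[OF f] by auto
  note fk = Comp_in_Hom[OF k(1) f]
  note d = diff_in_Hom[OF Idn_in_Hom fk]
  \<comment> \<open>The defect of \<open>k\<close> from being a section of \<open>f\<close> factors
    through \<open>Hom(Y, c0) = 0\<close>. Thus \<open>f\<close> is a split epimorphism, and
    \<open>q \<cdot> f = 0\<close> forces \<open>q = 0\<close>.\<close>
  have "(Idn C c0 - f \<cdot> k) \<cdot> f = 0"
    using Comp_diff_left[OF f Idn_in_Hom fk] Idn_Comp[OF f] Comp_assoc[OF f k(1) f] k(2) by simp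
  then obtain l where l: "l \<in> Hom C Y c0" "Idn C c0 - f \<cdot> k = l \<cdot> q"
    using Dist_extend[OF D d] by blast
  then have "Idn C c0 = f \<cdot> k"
    using Yc0 Comp_zero_left[OF q] by simp
  then have "q = (q \<cdot> f) \<cdot> k"
    using Comp_Idn[OF q] Comp_assoc[OF k(1) f q] by simp
  then have "q = 0"
    using Dist_Comp_zero[OF D] Comp_zero_left[OF k(1)] by simp
  then have eY: "Hom C e Y = {0}"
    using approx by (intro Hom_trivialI) fastforce
  have "Hom C E (Sh C W) = {0}" if "E \<in> {a, e}" for E
    using that eY Hom_U_V[OF a Y(1)] W by auto
  then have W_ad: "W \<in> ad {a, e}"
    by (rule cluster_tilting_set_ad[OF R])
  \<comment> \<open>Every detour \<open>W \<rightarrow> E \<rightarrow> W\<close> is zero: its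
    second half if \<open>E = a\<close>, its first half if \<open>E = e\<close>.\<close>
  have "Idn C W \<cdot> Idn C W = 0"
  proof (rule ad_cancel[OF W_ad Idn_in_Hom Idn_in_Hom])
    fix E p g
    assume E: "E \<in> {a, e}" and p: "p \<in> Hom C W E" and g: "g \<in> Hom C E W"
    have "Hom C a W = {0}"
      using Hom_U_V[OF a] V_unshift[of W] Y(1) W by simp
    moreover have "Hom C W e = {0}"
      using Y(2)[OF SSe] Hom_Sh_trivial_iff[of W e] W by simp
    ultimately have "g = 0 \<or> p = 0"
      using E p g by auto
    then show "(Idn C W \<cdot> g) \<cdot> (p \<cdot> Idn C W) = 0"
      using Comp_Idn[OF p] Idn_Comp[OF g] Comp_zero_left[OF p] Comp_zero_right[OF g] by auto
  qed
  then have "zero_object C W"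
    using Idn_Comp[OF Idn_in_Hom] by (simp add: zero_object_iff)
  then show ?thesis
    using zero_object_Sh_iff[of W] W by simp
qed

text \<open>For \<open>X\<close> in \<open>U\<close>, the \<open>V\<close>-part \<open>Y1\<close> of
  the truncation of \<open>X[-1]\<close> sits between \<open>X[-1]\<close> and \<open>X1[1]\<close>.
  So it has no morphisms to \<open>V[-1]\<close> and is zero by the preceding lemma; morphisms from
  \<open>X[-1]\<close> to \<open>V\<close> are then governed by \<open>X1\<close> in
  \<open>U\<close>.\<close>

lemma Sh_V:
  assumes "hom_finite C" "cluster_tilting_set {T}" "Y \<in> V"
  shows "Sh C Y \<in> V"
proof -
  obtain a e where R: "cluster_tilting_set {a, e}" "a \<in> U" "Sh C (Sh C e) \<in> V"
    using split_cluster_tilting_set[OF assms(1,2)] by blast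
  have "Hom C X (Sh C Y) = {0}" if X: "X \<in> U" for X
  proof -
    define W where "W = inv (Sh C) X"
    have W: "Sh C W = X"
      by (simp add: W_def)
    obtain X1 Y1 f g h where X1: "X1 \<in> U" and Y1: "Y1 \<in> V" and D: "Dist C X1 W Y1 f g h"
      by (rule truncationE)
    have "Hom C Y1 v = {0}" if v: "Sh C v \<in> V" for v
    proof (rule Hom_Dist_right[OF Dist_rotate[OF D]])
      show "Hom C W v = {0}"
        using Hom_U_V[OF X v] Hom_Sh_trivial_iff[of W v] W by simp
      show "Hom C (Sh C X1) v = {0}"
        by (rule Hom_U_V[OF Sh_U[OF X1] V_unshift[OF v]])
    qed
    then have "zero_object C Y1"
      by (rule zero_object_in_heart[OF assms(1) R Y1])
    then have "Hom C W Y = {0}"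
      using Hom_Dist_right[OF D] Hom_U_V[OF X1 assms(3)] by (simp add: zero_object_def)
    then show ?thesis
      using Hom_Sh_trivial_iff[of W Y] W by simp
  qed
  then show ?thesis
    by (simp add: V_def)
qed

lemma trivial:
  assumes fin: "hom_finite C" and T: "cluster_tilting_set {T}" and ind: "indecomposable C"
  shows "U \<subseteq> zero_subcat C \<or> V \<subseteq> zero_subcat C"
proof -
  \<comment> \<open>Being a left orthogonal, \<open>U'\<close> is closed under sums and summands,
    closure properties that the locale does not assume of \<open>U\<close>.\<close>
  define U' where "U' = {X. \<forall>Y \<in> V. Hom C X Y = {0}}"
  note Sh_V = Sh_V[OF fin T]
  have UU': "U \<subseteq> U'"
    using Hom_U_V by (auto simp: U'_def)
  have inv_V: "inv (Sh C) Y \<in> V" if "Y \<in> V" for Y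
    using that V_unshift[of "inv (Sh C) Y"] by simp
  have "triangulated_subcategory C V"
    unfolding triangulated_subcategory_def
  proof (intro conjI)
    show "subcategory C V"
      unfolding V_def by (rule subcategory_right_perp)
    show "star C V V \<subseteq> V"
      by (auto simp: star_def V_def Hom_Dist_left)
  qed (use Sh_V inv_V in blast)+
  moreover have "triangulated_subcategory C U'"
    unfolding triangulated_subcategory_def
  proof (intro conjI)
    show "subcategory C U'"
      unfolding U'_def by (rule subcategory_left_perp)
    show "star C U' U' \<subseteq> U'"
      by (auto simp: star_def U'_def Hom_Dist_right)
    have "Hom C (Sh C X) Y = {0}" if "X \<in> U'" "Y \<in> V" for X Y
      using that inv_V Hom_Sh_trivial_iff[of X "inv (Sh C) Y"] by (simp add: U'_def)
    then show "Sh C ` U' \<subseteq> U'"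
      by (auto simp: U'_def)
    have "Hom C (inv (Sh C) X) Y = {0}" if "X \<in> U'" "Y \<in> V" for X Y
      using that Sh_V Hom_Sh_trivial_iff[of "inv (Sh C) X" Y] by (simp add: U'_def)
    then show "inv (Sh C) ` U' \<subseteq> U'"
      by (auto simp: U'_def)
  qed
  moreover have "Hom_vanish C U' V"
    by (simp add: Hom_vanish_def U'_def)
  \<comment> \<open>\<open>Hom(Y, X)\<close> is dual to \<open>Hom(X, Y[2])\<close>, and
    \<open>V\<close> is now closed under the shift.\<close>
  moreover have "Hom_vanish C V U'"
    unfolding Hom_vanish_def
  proof (intro ballI)
    fix Y X
    assume "Y \<in> V" "X \<in> U'"
    then have "Hom C X (Sh C (Sh C Y)) = {0}"
      using Sh_V by (simp add: U'_def)
    then show "Hom C Y X = {0}"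
      by (rule calabi_yau_2_vanishing[OF cy])
  qed
  moreover have "\<exists>X \<in> U'. \<exists>Y \<in> V. direct_sum C Z [X, Y]" for Z
  proof -
    obtain X Y f g h where X: "X \<in> U" and Y: "Y \<in> V" and D: "Dist C X Z Y f g h"
      by (rule truncationE)
    \<comment> \<open>By symmetry of extensions this follows from \<open>Hom(X, Y[1]) = 0\<close>;
      the truncation triangle therefore splits.\<close>
    have "Hom C Y (Sh C X) = {0}"
      using Hom_U_V[OF X Sh_V[OF Y]] Hom_Sh_trivial_iff[of X "Sh C Y"]
      by (simp add: Ext_symmetric[OF cy])
    then have "h = 0"
      using Dist_Hom[OF D] by simp
    then have "direct_sum C Z [X, Y]"
      using D by (intro split_triangle[of X Z Y f g]) simp
    then show ?thesis
      using X Y UU' by blast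
  qed
  ultimately have "U' \<subseteq> zero_subcat C \<or> V \<subseteq> zero_subcat C"
    using ind unfolding indecomposable_def by blast
  then show ?thesis
    using UU' by blast
qed

end

section \<open>t-structures\<close>

context triangulated_category
begin

lemma subcategory_zero: "subcategory C (zero_subcat C)"
proof -
  \<comment> \<open>The zero objects form the right orthogonal of the whole category.\<close>
  have "zero_object C Y \<longleftrightarrow> (\<forall>X. Hom C X Y = {0})" for Y
  proof
    assume "\<forall>X. Hom C X Y = {0}"
    then have "Idn C Y \<in> {0}"
      using Idn_in_Hom[of Y] by metis
    then show "zero_object C Y"
      by (simp add: zero_object_iff)
  qed (simp add: zero_object_def)
  then show ?thesis
    using subcategory_right_perp[of UNIV] by (simp add: zero_subcat_def)
qed

lemma t_structure_UNIV_zero: "t_structure C UNIV (zero_subcat C)"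
proof -
  obtain N where N: "zero_object C N" "zero_object C (Sh C N)"
    using zero_object_exists zero_object_Sh_iff by metis
  have "Z \<in> star C UNIV (Sh C ` zero_subcat C)" for Z
    using TR1_Idn[OF N(2), of Z] N(1) unfolding star_def zero_subcat_def by blast
  moreover have "Hom_vanish C UNIV (Sh C ` zero_subcat C)"
    unfolding Hom_vanish_def
  proof (intro ballI)
    fix X Y
    assume "Y \<in> Sh C ` zero_subcat C"
    then have "zero_object C Y"
      using zero_object_Sh_iff by (auto simp: zero_subcat_def)
    then show "Hom C X Y = {0}"
      by (simp add: zero_object_def)
  qed
  moreover have "subcategory C UNIV"
    by (rule subcategoryI) simp_all
  ultimately show ?thesis
    using subcategory_zero by (auto simp: t_structure_def cotorsion_pair_def)
qed

lemma t_structure_zero_UNIV: "t_structure C (zero_subcat C) UNIV"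
proof -
  obtain N where N: "zero_object C N"
    by (rule zero_object_exists)
  have "Z \<in> star C (zero_subcat C) (Sh C ` UNIV)" for Z
    using Dist_zero_left[OF N, of Z] N Sh_inv(1)[of Z, symmetric]
    unfolding star_def zero_subcat_def by blast
  moreover have "Hom_vanish C (zero_subcat C) (Sh C ` UNIV)"
    by (simp add: Hom_vanish_def zero_subcat_def zero_object_def)
  moreover have "subcategory C UNIV"
    by (rule subcategoryI) simp_all
  ultimately show ?thesis
    using subcategory_zero zero_object_Sh_iff
    by (auto simp: t_structure_def cotorsion_pair_def zero_subcat_def)
qed

lemma t_structure_trivial:
  assumes "hom_finite C" "calabi_yau_2 C" "indecomposable C" "cluster_tilting C T"
    and t: "t_structure C A B"
  shows "(A, B) \<in> {(UNIV, zero_subcat C), (zero_subcat C, UNIV)}"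
proof -
  have A: "subcategory C A" and B: "subcategory C B"
    and van: "Hom_vanish C A (Sh C ` B)" and star: "star C A (Sh C ` B) = UNIV"
    and ShA: "Sh C ` A \<subseteq> A"
    using t by (simp_all add: t_structure_def cotorsion_pair_def)
  have tri: "\<exists>X \<in> A. \<exists>Y \<in> B. \<exists>f g h. Dist C X Z (Sh C Y) f g h" for Z
    using star unfolding star_def by blast
  interpret aisle C A
  proof
    show "Sh C X \<in> A" if "X \<in> A" for X
      using ShA that by blast
    fix Z
    obtain X Y f g h where "X \<in> A" "Y \<in> B" "Dist C X Z (Sh C Y) f g h"
      using tri by blast
    then show "\<exists>X \<in> A. \<exists>Y. (\<forall>W \<in> A. Hom C W Y = {0}) \<and> (\<exists>f g h. Dist C X Z Y f g h)"
      using van unfolding Hom_vanish_def by blast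
  qed (rule assms(2))
  have zero: "zero_subcat C \<subseteq> S" if "subcategory C S" for S
    using zero_object_in_subcategory[OF that] by (auto simp: zero_subcat_def)
  have ShB: "Sh C Y \<in> V" if "Y \<in> B" for Y
    using van that by (auto simp: V_def Hom_vanish_def)
  from trivial[OF assms(1) cluster_tilting_set_singleton[OF assms(4)] assms(3)] show ?thesis
  proof
    assume A0: "A \<subseteq> zero_subcat C"
    \<comment> \<open>The triangle \<open>X \<rightarrow> Y[1] \<rightarrow> b[1]\<close> rotates
      back to \<open>Y \<rightarrow> b \<rightarrow> X\<close> with connecting morphism
      \<open>f = 0\<close>, so \<open>Y\<close> is a summand of \<open>b\<close>.\<close>
    have "Y \<in> B" for Y
    proof -
      obtain X b f g h where X: "X \<in> A" and b: "b \<in> B" and D: "Dist C X (Sh C Y) (Sh C b) f g h"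
        using tri by blast
      obtain W k where W: "Sh C W = Sh C b" "Dist C W X (Sh C Y) k f g"
        using Dist_unrotate[OF D] by metis
      obtain W' k' where W': "Sh C W' = Sh C Y" "Dist C W' W X k' k f"
        using Dist_unrotate[OF W(2)] by metis
      have "W = b" "W' = Y"
        using W(1) W'(1) Sh_inv(2) by metis+
      moreover have "f = 0"
        using Dist_Hom[OF D] X A0 by (auto simp: zero_subcat_def zero_object_def)
      ultimately have "direct_sum C b [Y, X]"
        using W'(2) by (intro split_triangle[of Y b X k' k]) simp
      then show ?thesis
        using subcategory_direct_sum_iff[OF B] b by simp
    qed
    then show ?thesis
      using A0 zero[OF A] by auto
  next
    assume V0: "V \<subseteq> zero_subcat C"
    have B0: "B \<subseteq> zero_subcat C"
      using ShB V0 zero_object_Sh_iff by (auto simp: zero_subcat_def)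
    \<comment> \<open>Here \<open>b[1]\<close> is a zero object, so \<open>Z\<close> is the direct
      sum of \<open>X\<close> and a zero object, both in \<open>A\<close>.\<close>
    have "Z \<in> A" for Z
    proof -
      obtain X b f g h where X: "X \<in> A" and b: "b \<in> B" and D: "Dist C X Z (Sh C b) f g h"
        using tri by blast
      have b0: "Sh C b \<in> zero_subcat C"
        using ShB[OF b] V0 by blast
      then have "h = 0"
        using Dist_Hom[OF D] by (auto simp: zero_subcat_def zero_object_def)
      then have "direct_sum C Z [X, Sh C b]"
        using D by (intro split_triangle[of X Z "Sh C b" f g]) simp
      then show ?thesis
        using subcategory_direct_sum_iff[OF A] X b0 zero[OF A] by auto
    qed
    then show ?thesis
      using B0 zero[OF B] by auto
  qed
qed

end

theorem theorem4p1:
  fixes C :: "('k::field, 'o, 'm::ab_group_add) tri_cat" and T :: 'o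
  assumes "triangulated_category C"
    and "hom_finite C"
    and "krull_schmidt C"
    and "calabi_yau_2 C"
    and "indecomposable C"
    and "cluster_tilting C T"
  shows "{(A, B). t_structure C A B} = {(UNIV, zero_subcat C), (zero_subcat C, UNIV)}"
proof -
  interpret triangulated_category C
    by (rule assms(1))
  show ?thesis
    using t_structure_trivial[OF assms(2,4-6)] t_structure_UNIV_zero t_structure_zero_UNIV by blast
qed

end
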